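(* Let $D:=N$, let $\mathcal I^{D}:=[0,T]^{D}\times\mathcal B^{D}$, and let $\overline{x}\in\mathbb R^d$. Suppose that for every $\varepsilon>0$ one has $\overline{x}\in\mathcal X_\varepsilon$, where $\mathcal X_\varepsilon=\{y\in\mathbb R^d : V(y,\varepsilon)<+\infty\}$, and that the strict feasibility condition stated in the context holds for $\overline x$. For $\varepsilon>0$ consider the maximization problem $$\sup_{(\mathfrak t,\mathfrak b)\in\mathcal I^{D}} G(\overline{x},\varepsilon;\mathfrak t,\mathfrak b).$$ Then: (1) for every $\varepsilon>0$, the function $\mathcal I^D\ni(\mathfrak t,\mathfrak b)\mapsto G(\overline x,\varepsilon;\mathfrak t,\mathfrak b)$ is continuous, and there exists $(\mathfrak t^{*}(\overline x,\varepsilon),\mathfrak b^{*}(\overline x,\varepsilon))\in\mathcal I^D$ that solves this maximization problem; (2) for every $\varepsilon>0$, $V(\overline{x},\varepsilon)=G\bigl(\overline{x},\varepsilon;\mathfrak t^{*}(\overline x,\varepsilon),\mathfrak b^{*}(\overline x,\varepsilon)\bigr)$; (3) the family $(\Theta^{*}_{\overline x,\varepsilon})_{\varepsilon>0}$, where $\Theta^{*}_{\overline x,\varepsilon}$ is the minimizer of $\Theta\mapsto J(\Theta)+\varepsilon R(\Theta)$ over all $\Theta\in\mathcal A$ satisfying the constraints of the relaxed problem defining $G(\overline x,\varepsilon;\mathfrak t,\mathfrak b)$ at $(\mathfrak t,\mathfrak b)=(\mathfrak t^{*}(\overline x,\varepsilon),\mathfrak b^{*}(\overline x,\varepsilon))$,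 converges as $\varepsilon\downarrow0$ to an optimizer of the unregularized program $$\inf_{\Theta\in\mathcal A}\ J(\Theta)\quad\text{subject to}\quad z_1(T;\Theta,\beta)\in X_F,\ z_2(T;\Theta)=0,\ |\Theta\Psi(t)|\le r\ \text{ for all }(t,\beta)\in[0,T]\times\mathcal B.$$
   Context: Setting (robust minimum attention problem). Let $d\in\mathbb N$, $T>0$, $r>0$, $\nu\in\mathbb R$, $A\in\mathbb R^{d\times d}$, $b\in\mathbb R^d$. The system is $\dot x(t)=Ax(t)+bu(t)+w(t)$ with $x(t)\in\mathbb R^d$, $u(t)\in\mathbb R$, $w(t)\in\mathbb W$, where $\mathbb W=\prod_{j=1}^d[-\bar w^j,\bar w^j]$ with each $\bar w^j>0$. The problem is to minimize $\int_0^T|\dot u(t)|\,dt$ subject to $x(0)=\overline x$, $x(T)\in X_F$, $u(0)=\nu$, $u(T)=0$, $|\dot u(t)|\le r$, for all admissible disturbances; it is assumed well-posed. Here $X_F\subset\mathbb R^d$ is compact and convex with $0$ in its interior. Setting $v=\dot u$ and $z=(z_1,z_2)=(x,u)\in\mathbb R^d\times\mathbb R$ gives $$\dot z(t)=\bar A z(t)+\bar B v(t)+\bar c\,w(t),\quad \bar A=\begin{pmatrix}A&b\\0&0\end{pmatrix},\ \bar B=\begin{pmatrix}0\\1\end{pmatrix},\ \bar c=\begin{pmatrix}I_d\\0\end{pmatrix},\quad z(0)=(\overline x,\nu).$$ Piecewise constant functions. Fix $h>0$ and a uniform partition $0=t_0<\cdots<t_K\le T$ with $t_k-t_{k-1}=h$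 for $k=1,\dots,K$ and $T-t_K\le h$. $\mathrm{PC}_h([0,T];\mathbb R)$ is the set of functions $y:[0,T]\to\mathbb R$ that are constant on each $[t_{k-1},t_k)$, $k=1,\dots,K$, and constant on $[t_K,T]$. Parametrization. Let $N,M\in\mathbb N$; let $\psi_1,\dots,\psi_N\in\mathrm{PC}_h([0,T];\mathbb R)$ be linearly independent with $\max_i\max_t|\psi_i(t)|=1$, and let $\varphi_1,\dots,\varphi_M\in\mathrm{PC}_h([0,T];\mathbb R)$ be linearly independent with $\max_j\max_t|\varphi_j(t)|=1$. Put $\Psi=(\psi_1,\dots,\psi_N)^{\top}$, $\Phi=(\varphi_1,\dots,\varphi_M)^{\top}$. Take $v(t)=\Theta\Psi(t)$ with $\Theta\in\mathbb R^{1\times N}$ and $w(t)=\beta\Phi(t)$ with $\beta\in\mathbb R^{d\times M}$. Set $$\mathcal A=\{\Theta\in\mathbb R^{1\times N}:|\Theta\Psi(t)|\le r\ \forall t\in[0,T]\},\qquad \mathcal B=\{\beta\in\mathbb R^{d\times M}:\beta\Phi(t)\in\mathbb W\ \forall t\in[0,T]\}.$$ Let $z(t;\Theta,\beta)=(z_1(t;\Theta,\beta),z_2(t;\Theta))$ denote the corresponding solution, so $z(t;\Theta,\beta)=e^{\bar At}(\overline x,\nu)^{\top}+\int_0^te^{\bar A(t-\tau)}\bigl(\bar B\Theta\Psi(\tau)+\bar c\beta\Phi(\tau)\bigr)d\tau$ (its last component does not depend on $\beta$). Objective. $J(\Theta)=\int_0^T|\Theta\Psi(t)|\,dt$, and $R:\mathbb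 R^{1\times N}\to\mathbb R$ is continuous, positive and strictly convex. Regularized program. $V(\overline x,\varepsilon)$ is the optimal value ($+\infty$ if infeasible) of $$\inf_{\Theta\in\mathcal A}\ J(\Theta)+\varepsilon R(\Theta)\quad\text{s.t. } z_1(T;\Theta,\beta)\in X_F,\ z_2(T;\Theta)=0,\ |\Theta\Psi(t)|\le r\ \ \forall(t,\beta)\in[0,T]\times\mathcal B.$$ Relaxed program. For $\mathfrak t=(t^1,\dots,t^D)\in[0,T]^D$ and $\mathfrak b=(\beta^1,\dots,\beta^D)\in\mathcal B^D$ with $D=N$, $G(\overline x,\varepsilon;\mathfrak t,\mathfrak b)$ is the optimal value of $$\inf_{\Theta\in\mathcal A}\ J(\Theta)+\varepsilon R(\Theta)\quad\text{s.t. } z_1(T;\Theta,\beta^i)\in X_F,\ z_2(T;\Theta)=0,\ |\Theta\Psi(t^i)|\le r,\ \ i=1,\dots,D.$$ Strict feasibility condition. There exists $\Theta\in\mathbb R^{1\times N}$ with $|\Theta\Psi(t)|<r$ for all $t\in[0,T]$, $z_2(T;\Theta)=0$, and $z_1(T;\Theta,\beta)\in\operatorname{int}X_F$ for all $\beta\in\mathcal B$. *)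

theory Defs
  imports "HOL-Analysis.Analysis"
begin

text \<open>
  The matrix exponential. On \<open>real^'k^'k\<close> the library's type-class multiplication (hence \<open>^\<close>) is
  componentwise, so the powers are taken with respect to the matrix product \<open>**\<close>.
\<close>

definition mat_exp :: "real^'k^'k \<Rightarrow> real^'k^'k"
  where "mat_exp A = (\<Sum>n. (1 / fact n) *\<^sub>R (((**) A ^^ n) (mat 1)))"

definition strictly_convex_on :: "'a::real_vector set \<Rightarrow> ('a \<Rightarrow> real) \<Rightarrow> bool"
  where "strictly_convex_on S f \<longleftrightarrow> convex S \<and>
    (\<forall>x\<in>S. \<forall>y\<in>S. \<forall>s. x \<noteq> y \<and> 0 < s \<and> s < 1 \<longrightarrow>
      f ((1 - s) *\<^sub>R x + s *\<^sub>R y) < (1 - s) * f x + s * f y)"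

text \<open>
  Piecewise constant functions on \<open>[0,T]\<close> for the partition \<open>t\<^sub>k = k h\<close>, \<open>k = 0, \<dots>, K\<close>.
  Functions on \<open>[0,T]\<close> are represented by total functions whose values outside \<open>[0,T]\<close> are
  never used.
\<close>

definition PC :: "real \<Rightarrow> nat \<Rightarrow> real \<Rightarrow> (real \<Rightarrow> real) set"
  where "PC h K T = {y. (\<forall>k\<in>{1..K}. y constant_on {real (k - 1) * h ..< real k * h}) \<and>
                        y constant_on {real K * h .. T}}"

text \<open>
  The data of the parametrized problem, apart from the initial state. The state dimension \<open>d\<close> and
  the numbers \<open>N\<close>, \<open>M\<close> of basis functions are the cardinalities of the index types \<open>'d\<close>, \<open>'n\<close>,
  \<open>'m\<close>. The row vectors \<open>\<Theta>\<close> in \<open>R\<^sup>1\<^sup>\<times>\<^sup>N\<close> have type \<open>real^'n\<close>, so that \<open>\<Theta>\<Psi>(t)\<close> is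
  \<open>\<Theta> \<bullet> \<Psi> t\<close>; the matrices \<open>\<beta>\<close> in \<open>R\<^sup>d\<^sup>\<times>\<^sup>M\<close> have type \<open>real^'m^'d\<close>.
\<close>

record ('d::finite, 'n::finite, 'm::finite) attention_problem =
  horizon :: real                    \<comment> \<open>\<open>T\<close>\<close>
  rate :: real                       \<comment> \<open>\<open>r\<close>\<close>
  control0 :: real                   \<comment> \<open>\<open>\<nu> = u(0)\<close>\<close>
  sysA :: "real^'d^'d"
  sysb :: "real^'d"
  wbar :: "real^'d"
  XF :: "(real^'d) set"
  Psi :: "real \<Rightarrow> real^'n"
  Phi :: "real \<Rightarrow> real^'m"
  reg :: "real^'n \<Rightarrow> real"            \<comment> \<open>\<open>R\<close>\<close>

text \<open>The augmented system for \<open>z = (x, u)\<close>, with coordinates \<open>Inl i\<close> for \<open>x\<close> and \<open>Inr ()\<close> for \<open>u\<close>.\<close>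

definition Abar :: "('d::finite, 'n::finite, 'm::finite) attention_problem \<Rightarrow>
    real^('d + unit)^('d + unit)"
  where "Abar P = (\<chi> i j. case i of
      Inl i' \<Rightarrow> (case j of Inl j' \<Rightarrow> sysA P $ i' $ j' | Inr _ \<Rightarrow> sysb P $ i')
    | Inr _ \<Rightarrow> 0)"

definition Bbar :: "real^('d::finite + unit)"
  where "Bbar = (\<chi> i. case i of Inl _ \<Rightarrow> 0 | Inr _ \<Rightarrow> 1)"

definition cbar :: "real^'d^('d + unit)"
  where "cbar = (\<chi> i j. case i of Inl i' \<Rightarrow> (if i' = j then 1 else 0) | Inr _ \<Rightarrow> 0)"

definition init :: "('d::finite, 'n::finite, 'm::finite) attention_problem \<Rightarrow> real^'d \<Rightarrow>
    real^('d + unit)"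
  where "init P x = (\<chi> i. case i of Inl i' \<Rightarrow> x $ i' | Inr _ \<Rightarrow> control0 P)"

definition z :: "('d::finite, 'n::finite, 'm::finite) attention_problem \<Rightarrow> real^'d \<Rightarrow>
    real^'n \<Rightarrow> real^'m^'d \<Rightarrow> real \<Rightarrow> real^('d + unit)"
  where "z P x \<Theta> \<beta> t = mat_exp (t *\<^sub>R Abar P) *v init P x +
    integral {0..t} (\<lambda>\<tau>. mat_exp ((t - \<tau>) *\<^sub>R Abar P) *v
      ((\<Theta> \<bullet> Psi P \<tau>) *\<^sub>R Bbar + cbar *v (\<beta> *v Phi P \<tau>)))"

definition z1 :: "('d::finite, 'n::finite, 'm::finite) attention_problem \<Rightarrow> real^'d \<Rightarrow>
    real^'n \<Rightarrow> real^'m^'d \<Rightarrow> real \<Rightarrow> real^'d"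
  where "z1 P x \<Theta> \<beta> t = (\<chi> i. z P x \<Theta> \<beta> t $ Inl i)"

text \<open>
  The last component of \<open>z\<close> does not depend on \<open>\<beta>\<close> (lemma \<open>z_Inr_eq_z2\<close> below), which allows \<open>\<beta> = 0\<close>
  in its definition.
\<close>

definition z2 :: "('d::finite, 'n::finite, 'm::finite) attention_problem \<Rightarrow> real^'d \<Rightarrow>
    real^'n \<Rightarrow> real \<Rightarrow> real"
  where "z2 P x \<Theta> t = z P x \<Theta> 0 t $ Inr ()"

definition control_set :: "('d::finite, 'n::finite, 'm::finite) attention_problem \<Rightarrow> (real^'n) set"
  where "control_set P = {\<Theta>. \<forall>t\<in>{0..horizon P}. \<bar>\<Theta> \<bullet> Psi P t\<bar> \<le> rate P}"

definition disturbance_set :: "('d::finite, 'n::finite, 'm::finite) attention_problem \<Rightarrow>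
    (real^'m^'d) set"
  where "disturbance_set P =
    {\<beta>. \<forall>t\<in>{0..horizon P}. \<beta> *v Phi P t \<in> cbox (- wbar P) (wbar P)}"

definition J :: "('d::finite, 'n::finite, 'm::finite) attention_problem \<Rightarrow> real^'n \<Rightarrow> real"
  where "J P \<Theta> = integral {0..horizon P} (\<lambda>t. \<bar>\<Theta> \<bullet> Psi P t\<bar>)"

definition robust_feasible :: "('d::finite, 'n::finite, 'm::finite) attention_problem \<Rightarrow> real^'d \<Rightarrow>
    (real^'n) set"
  where "robust_feasible P x = {\<Theta> \<in> control_set P.
    \<forall>(t, \<beta>) \<in> {0..horizon P} \<times> disturbance_set P.
      z1 P x \<Theta> \<beta> (horizon P) \<in> XF P \<and> z2 P x \<Theta> (horizon P) = 0 \<and> \<bar>\<Theta> \<bullet> Psi P t\<bar> \<le> rate P}"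

text \<open>The infimum over the empty set is \<open>\<infinity>\<close> in \<open>ereal\<close>.\<close>

definition V :: "('d::finite, 'n::finite, 'm::finite) attention_problem \<Rightarrow> real^'d \<Rightarrow> real \<Rightarrow> ereal"
  where "V P x \<epsilon> = (INF \<Theta> \<in> robust_feasible P x. ereal (J P \<Theta> + \<epsilon> * reg P \<Theta>))"

definition feasible_states :: "('d::finite, 'n::finite, 'm::finite) attention_problem \<Rightarrow> real \<Rightarrow>
    (real^'d) set"
  where "feasible_states P \<epsilon> = {y. V P y \<epsilon> < \<infinity>}"

text \<open>
  Here \<open>D = N\<close>: the \<open>D\<close>-tuples of times and of disturbance parameters are indexed by \<open>'n\<close>, the
  index type of the components of \<open>\<Theta>\<close>.
\<close>

definition sample_set :: "('d::finite, 'n::finite, 'm::finite) attention_problem \<Rightarrow>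
    ((real^'n) \<times> ((real^'m^'d)^'n)) set"
  where "sample_set P =
    {\<tt>. \<forall>i. \<tt> $ i \<in> {0..horizon P}} \<times> {\<bb>. \<forall>i. \<bb> $ i \<in> disturbance_set P}"

definition relaxed_feasible :: "('d::finite, 'n::finite, 'm::finite) attention_problem \<Rightarrow> real^'d \<Rightarrow>
    (real^'n) \<times> ((real^'m^'d)^'n) \<Rightarrow> (real^'n) set"
  where "relaxed_feasible P x = (\<lambda>(\<tt>, \<bb>). {\<Theta> \<in> control_set P.
    \<forall>i. z1 P x \<Theta> (\<bb> $ i) (horizon P) \<in> XF P \<and> z2 P x \<Theta> (horizon P) = 0 \<and>
        \<bar>\<Theta> \<bullet> Psi P (\<tt> $ i)\<bar> \<le> rate P})"

definition G :: "('d::finite, 'n::finite, 'm::finite) attention_problem \<Rightarrow> real^'d \<Rightarrow> real \<Rightarrow>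
    (real^'n) \<times> ((real^'m^'d)^'n) \<Rightarrow> ereal"
  where "G P x \<epsilon> q = (INF \<Theta> \<in> relaxed_feasible P x q. ereal (J P \<Theta> + \<epsilon> * reg P \<Theta>))"

definition strictly_feasible :: "('d::finite, 'n::finite, 'm::finite) attention_problem \<Rightarrow>
    real^'d \<Rightarrow> bool"
  where "strictly_feasible P x \<longleftrightarrow> (\<exists>\<Theta>.
    (\<forall>t\<in>{0..horizon P}. \<bar>\<Theta> \<bullet> Psi P t\<bar> < rate P) \<and> z2 P x \<Theta> (horizon P) = 0 \<and>
    (\<forall>\<beta>\<in>disturbance_set P. z1 P x \<Theta> \<beta> (horizon P) \<in> interior (XF P)))"

subsection \<open>The last component of the state is independent of the disturbance\<close>

lemma bounded_bilinear_mult_mat: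
  "bounded_bilinear ((**) :: real^'k^'k \<Rightarrow> real^'k^'k \<Rightarrow> real^'k^'k)"
proof -
  have "bilinear ((**) :: real^'k^'k \<Rightarrow> real^'k^'k \<Rightarrow> real^'k^'k)"
    unfolding bilinear_def
    by (auto intro!: linearI simp: vec_eq_iff matrix_matrix_mult_def sum.distrib algebra_simps
        sum_distrib_left)
  then show ?thesis by (simp add: bilinear_conv_bounded_bilinear)
qed

lemma mat_power_bound:
  fixes A :: "real^'k^'k"
  shows "\<exists>C\<ge>0. \<forall>n. norm (((**) A ^^ n) (mat 1)) \<le> norm (mat 1 :: real^'k^'k) * C ^ n"
proof -
  obtain L where L: "0 \<le> L" "\<And>(A :: real^'k^'k) (B :: real^'k^'k). norm (A ** B) \<le> norm A * norm B * L"
    using bounded_bilinear.nonneg_bounded[OF bounded_bilinear_mult_mat] by blast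
  have "norm (((**) A ^^ n) (mat 1)) \<le> norm (mat 1 :: real^'k^'k) * (norm A * L) ^ n" for n
  proof (induction n)
    case (Suc n)
    let ?p = "((**) A ^^ n) (mat 1)"
    have "norm (A ** ?p) \<le> norm A * norm ?p * L" by (rule L(2))
    also have "\<dots> = norm ?p * (norm A * L)" by (simp only: mult_ac)
    also have "\<dots> \<le> norm (mat 1 :: real^'k^'k) * (norm A * L) ^ n * (norm A * L)"
      by (intro mult_right_mono Suc.IH mult_nonneg_nonneg L(1) norm_ge_zero)
    also have "\<dots> = norm (mat 1 :: real^'k^'k) * (norm A * L) ^ Suc n"
      by (simp only: power_Suc mult_ac)
    finally show ?case by (simp only: funpow.simps o_apply)
  qed simp
  then show ?thesis
    by (meson L(1) mult_nonneg_nonneg norm_ge_zero)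
qed

lemma mat_power_scaleR:
  fixes A :: "real^'k^'k"
  shows "((**) (s *\<^sub>R A) ^^ n) (mat 1) = s ^ n *\<^sub>R ((**) A ^^ n) (mat 1 :: real^'k^'k)"
proof (induction n)
  case (Suc n)
  have "((**) (s *\<^sub>R A) ^^ Suc n) (mat 1) = (s *\<^sub>R A) ** (s ^ n *\<^sub>R ((**) A ^^ n) (mat 1))"
    by (simp only: funpow.simps o_apply Suc.IH)
  also have "\<dots> = (s * s ^ n) *\<^sub>R (A ** ((**) A ^^ n) (mat 1))"
    by (simp only: scaleR_scaleR mult.commute bounded_bilinear.scaleR_left[OF bounded_bilinear_mult_mat]
        bounded_bilinear.scaleR_right[OF bounded_bilinear_mult_mat])
  finally show ?case
    by (simp only: funpow.simps o_apply power_Suc)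
qed simp

lemma
  fixes A :: "real^'k^'k"
  shows mat_exp_sums: "(\<lambda>n. (1 / fact n) *\<^sub>R (((**) A ^^ n) (mat 1))) sums mat_exp A"
  and continuous_on_mat_exp_scaleR: "continuous_on {a..b} (\<lambda>s. mat_exp (s *\<^sub>R A))"
proof -
  have *: "uniform_limit {a..b}
      (\<lambda>n s. \<Sum>i<n. (1 / fact i) *\<^sub>R (((**) (s *\<^sub>R A) ^^ i) (mat 1)))
      (\<lambda>s. mat_exp (s *\<^sub>R A)) sequentially" for A :: "real^'k^'k" and a b :: real
  proof -
    obtain C where C: "C \<ge> 0"
      "\<And>n. norm (((**) A ^^ n) (mat 1)) \<le> norm (mat 1 :: real^'k^'k) * C ^ n"
      using mat_power_bound by blast
    define m where "m = max \<bar>a\<bar> \<bar>b\<bar>"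
    show ?thesis
      unfolding mat_exp_def
    proof (rule Weierstrass_m_test)
      fix n s assume "s \<in> {a..b}"
      then have s: "\<bar>s\<bar> \<le> m" by (auto simp: m_def)
      have "norm ((1 / fact n) *\<^sub>R (((**) (s *\<^sub>R A) ^^ n) (mat 1)))
          = (1 / fact n) * (\<bar>s\<bar> ^ n * norm (((**) A ^^ n) (mat 1)))"
        by (simp only: mat_power_scaleR norm_scaleR) (simp add: power_abs)
      also have "\<dots> \<le> (1 / fact n) * (m ^ n * (norm (mat 1 :: real^'k^'k) * C ^ n))"
        using s C by (intro mult_left_mono mult_mono power_mono) auto
      finally show "norm ((1 / fact n) *\<^sub>R (((**) (s *\<^sub>R A) ^^ n) (mat 1)))
          \<le> norm (mat 1 :: real^'k^'k) * ((m * C) ^ n /\<^sub>R fact n)"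
        by (simp only: power_mult_distrib divide_inverse mult_1_left real_scaleR_def mult_ac)
    next
      show "summable (\<lambda>n. norm (mat 1 :: real^'k^'k) * ((m * C) ^ n /\<^sub>R fact n))"
        by (intro summable_mult summable_exp_generic)
    qed
  qed
  show "(\<lambda>n. (1 / fact n) *\<^sub>R (((**) A ^^ n) (mat 1))) sums mat_exp A"
    using tendsto_uniform_limitI[OF *[of A 1 1], of 1]
    by (simp only: sums_def scaleR_one atLeastAtMost_singleton singletonI simp_thms)
  show "continuous_on {a..b} (\<lambda>s. mat_exp (s *\<^sub>R A))"
    by (rule uniform_limit_theorem[OF _ *], simp only: mat_power_scaleR)
      (intro always_eventually allI continuous_intros, rule trivial_limit_sequentially)
qed

lemma mat_exp_Abar_Inr:
  fixes P :: "('d::finite, 'n::finite, 'm::finite) attention_problem"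
  shows "mat_exp (s *\<^sub>R Abar P) $ Inr () = mat 1 $ Inr ()"
proof -
  define p where "p = (\<lambda>n. ((**) (s *\<^sub>R Abar P) ^^ n) (mat 1))"
  have "(\<lambda>n. ((1 / fact n) *\<^sub>R p n) $ Inr ()) sums (mat_exp (s *\<^sub>R Abar P) $ Inr ())"
    unfolding p_def by (intro bounded_linear.sums[OF bounded_linear_vec_nth] mat_exp_sums)
  moreover have "(\<lambda>n. ((1 / fact n) *\<^sub>R p n) $ Inr ()) = (\<lambda>n. if n = 0 then mat 1 $ Inr () else 0)"
  proof
    fix n
    show "((1 / fact n) *\<^sub>R p n) $ Inr () = (if n = 0 then mat 1 $ Inr () else 0)"
    proof (cases n)
      case 0
      then show ?thesis by (simp add: p_def)
    next
      case (Suc k)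
      have "p n = (s *\<^sub>R Abar P) ** p k" by (simp only: p_def Suc funpow.simps o_apply)
      also have "\<dots> $ Inr () = 0"
        by (simp add: matrix_matrix_mult_def Abar_def vec_eq_iff)
      finally show ?thesis by (simp add: Suc)
    qed
  qed
  ultimately have "(\<lambda>n. if n = 0 then mat 1 $ Inr () else 0) sums (mat_exp (s *\<^sub>R Abar P) $ Inr ())"
    by (simp only:)
  then show ?thesis
    using sums_single[of 0 "\<lambda>_. mat 1 $ Inr ()"] by (rule sums_unique2)
qed

lemma PC_scale: "y \<in> PC h K T \<Longrightarrow> (\<lambda>t. c * y t) \<in> PC h K T"
  by (fastforce simp: PC_def constant_on_def)

lemma PC_sum:
  assumes "\<And>i. i \<in> I \<Longrightarrow> y i \<in> PC h K T"
  shows "(\<lambda>t. \<Sum>i\<in>I. y i t) \<in> PC h K T"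
proof -
  have "(\<lambda>t. \<Sum>i\<in>I. y i t) constant_on S" if "\<And>i. i \<in> I \<Longrightarrow> y i constant_on S" for S
  proof -
    have "\<forall>i\<in>I. \<exists>c. \<forall>t\<in>S. y i t = c"
      using that by (auto simp: constant_on_def)
    then obtain c where "\<forall>i\<in>I. \<forall>t\<in>S. y i t = c i"
      using bchoice by metis
    then show ?thesis unfolding constant_on_def by (intro exI[of _ "sum c I"]) simp
  qed
  then show ?thesis using assms by (simp add: PC_def)
qed

lemma PC_scaleR_integrable:
  fixes F :: "real \<Rightarrow> 'a::euclidean_space"
  assumes y: "y \<in> PC h K T" and h: "0 < h" "real K * h \<le> T"
    and t: "t \<le> T" and F: "continuous_on {0..T} F"
  shows "(\<lambda>\<tau>. y \<tau> *\<^sub>R F \<tau>) integrable_on {0..t}"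
proof -
  have "(\<lambda>\<tau>. y \<tau> *\<^sub>R F \<tau>) integrable_on {0..real k * h}" if "k \<le> K" for k
    using that
  proof (induction k)
    case (Suc k)
    define p q where "p = real k * h" and "q = real (Suc k) * h"
    have le: "0 \<le> p" "p \<le> q" "q \<le> T"
    proof -
      show "0 \<le> p" "p \<le> q"
        using h(1) unfolding p_def q_def by (auto intro!: mult_right_mono mult_nonneg_nonneg simp del: of_nat_Suc)
      have "q \<le> real K * h"
        using h(1) Suc.prems unfolding q_def by (intro mult_right_mono) auto
      with h(2) show "q \<le> T" by (rule order_trans[rotated])
    qed
    have "Suc k \<in> {1..K}" using Suc.prems by simp
    then have "y constant_on {real (Suc k - 1) * h ..< real (Suc k) * h}"
      using y unfolding PC_def by blast
    then obtain c where c: "\<And>\<tau>. \<tau> \<in> {p..<q} \<Longrightarrow> y \<tau> = c"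
      unfolding constant_on_def p_def q_def diff_Suc_1 by blast
    have "continuous_on {p..q} (\<lambda>\<tau>. c *\<^sub>R F \<tau>)"
      using le by (intro continuous_intros continuous_on_subset[OF F]) auto
    then have "(\<lambda>\<tau>. c *\<^sub>R F \<tau>) integrable_on {p..q}"
      by (rule integrable_continuous_real)
    then have "(\<lambda>\<tau>. y \<tau> *\<^sub>R F \<tau>) integrable_on {p..q}"
      by (rule integrable_spike[where S = "{q}"]) (use c in auto)
    moreover have "(\<lambda>\<tau>. y \<tau> *\<^sub>R F \<tau>) integrable_on {0..p}"
      using Suc.IH Suc.prems by (simp add: p_def)
    ultimately show ?case
      using Henstock_Kurzweil_Integration.integrable_combine[OF le(1,2)] by (simp only: q_def)
  next
    case 0
    show ?case using integrable_on_refl[of "\<lambda>\<tau>. y \<tau> *\<^sub>R F \<tau>" "0::real"] by simp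
  qed
  then have 1: "(\<lambda>\<tau>. y \<tau> *\<^sub>R F \<tau>) integrable_on {0..real K * h}" by simp
  obtain c where c: "\<And>\<tau>. \<tau> \<in> {real K * h..T} \<Longrightarrow> y \<tau> = c"
    using y unfolding PC_def constant_on_def by blast
  have "continuous_on {real K * h..T} (\<lambda>\<tau>. c *\<^sub>R F \<tau>)"
    using h by (intro continuous_intros continuous_on_subset[OF F]) auto
  then have "(\<lambda>\<tau>. c *\<^sub>R F \<tau>) integrable_on {real K * h..T}"
    by (rule integrable_continuous_real)
  then have "(\<lambda>\<tau>. y \<tau> *\<^sub>R F \<tau>) integrable_on {real K * h..T}"
    by (rule integrable_spike[where S = "{}"]) (use c in \<open>auto\<close>)
  with 1 have "(\<lambda>\<tau>. y \<tau> *\<^sub>R F \<tau>) integrable_on {0..T}"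
    by (rule Henstock_Kurzweil_Integration.integrable_combine[rotated 2]) (use h in auto)
  then show ?thesis
    by (rule integrable_subinterval_real) (use t in auto)
qed

lemma z_Inr:
  fixes P :: "('d::finite, 'n::finite, 'm::finite) attention_problem"
  assumes h: "0 < h" "real K * h \<le> horizon P" and t: "t \<in> {0..horizon P}"
    and Psi: "\<And>i. (\<lambda>\<tau>. Psi P \<tau> $ i) \<in> PC h K (horizon P)"
    and Phi: "\<And>j. (\<lambda>\<tau>. Phi P \<tau> $ j) \<in> PC h K (horizon P)"
  shows "z P x \<Theta> \<beta> t $ Inr () = control0 P + integral {0..t} (\<lambda>\<tau>. \<Theta> \<bullet> Psi P \<tau>)"
proof -
  let ?E = "\<lambda>\<tau>. mat_exp ((t - \<tau>) *\<^sub>R Abar P)"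
  let ?g = "\<lambda>\<tau>. (\<Theta> \<bullet> Psi P \<tau>) *\<^sub>R Bbar + cbar *v (\<beta> *v Phi P \<tau>) :: real^('d + unit)"
  have row: "(mat_exp (s *\<^sub>R Abar P) *v v) $ Inr () = v $ Inr ()" for s v
  proof -
    have "(mat_exp (s *\<^sub>R Abar P) *v v) $ Inr () = (mat 1 *v v) $ Inr ()"
      by (simp only: matrix_vector_mult_def mat_exp_Abar_Inr vec_lambda_beta)
    then show ?thesis by simp
  qed
  have g: "(\<lambda>\<tau>. ?g \<tau> $ i) \<in> PC h K (horizon P)" for i
  proof (cases i)
    case (Inl i')
    then have "(\<lambda>\<tau>. ?g \<tau> $ i) = (\<lambda>\<tau>. \<Sum>j\<in>UNIV. \<beta> $ i' $ j * Phi P \<tau> $ j)"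
      by (simp add: Bbar_def cbar_def matrix_vector_mult_def if_distrib[where f = "\<lambda>x. x * _"]
          cong: if_cong)
    then show ?thesis by (simp add: PC_sum PC_scale Phi)
  next
    case (Inr u)
    then have "(\<lambda>\<tau>. ?g \<tau> $ i) = (\<lambda>\<tau>. \<Sum>j\<in>UNIV. \<Theta> $ j * Psi P \<tau> $ j)"
      by (simp add: Bbar_def cbar_def matrix_vector_mult_def inner_vec_def)
    then show ?thesis by (simp add: PC_sum PC_scale Psi)
  qed
  have "continuous_on {0..horizon P} (\<lambda>\<tau>. column i (?E \<tau>))" for i
  proof -
    have "continuous_on {0..horizon P} ?E"
      by (rule continuous_on_compose2[OF continuous_on_mat_exp_scaleR[of "t - horizon P" t]])
        (auto intro!: continuous_intros)
    then show ?thesis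
      unfolding column_def by (intro continuous_intros)
  qed
  then have "(\<lambda>\<tau>. \<Sum>i\<in>UNIV. (?g \<tau> $ i) *\<^sub>R column i (?E \<tau>)) integrable_on {0..t}"
    using t by (intro integrable_sum PC_scaleR_integrable[OF g h]) auto
  then have "(\<lambda>\<tau>. ?E \<tau> *v ?g \<tau>) integrable_on {0..t}"
    by (simp only: matrix_mult_sum scalar_mult_eq_scaleR)
  then have "integral {0..t} (\<lambda>\<tau>. ?E \<tau> *v ?g \<tau>) $ Inr () = integral {0..t} (\<lambda>\<tau>. ?g \<tau> $ Inr ())"
    by (simp only: integral_component_eq_cart[symmetric] row)
  also have "(\<lambda>\<tau>. ?g \<tau> $ Inr ()) = (\<lambda>\<tau>. \<Theta> \<bullet> Psi P \<tau>)"
    by (simp add: Bbar_def cbar_def matrix_vector_mult_def)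
  finally show ?thesis
    by (simp only: z_def vector_add_component row) (simp add: init_def)
qed

lemma z_Inr_eq_z2:
  assumes "0 < h" "real K * h \<le> horizon P" "t \<in> {0..horizon P}"
    and "\<And>i. (\<lambda>\<tau>. Psi P \<tau> $ i) \<in> PC h K (horizon P)"
    and "\<And>j. (\<lambda>\<tau>. Phi P \<tau> $ j) \<in> PC h K (horizon P)"
  shows "z P x \<Theta> \<beta> t $ Inr () = z2 P x \<Theta> t"
  unfolding z2_def by (simp only: z_Inr[OF assms])

end

theory Submission
  imports Defs
begin

text \<open>
  At the horizon the state is affine in \<open>(\<Theta>, \<beta>)\<close>, so for each disturbance parameter \<open>\<beta>\<close> the controls
  \<open>\<Theta> \<in> control_set P\<close> that steer the state into \<open>XF\<close> with \<open>u(T) = 0\<close> form a compact convex set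
  \<open>scenario_feasible \<beta>\<close>. The robust program minimizes over the intersection of all these sets, the
  relaxed program over the intersection of \<open>N\<close> of them.

  \<^item> Continuity of \<open>G\<close>. The strictly feasible control keeps a uniform distance \<open>\<rho>\<close> to the boundary of
    \<open>XF\<close>, since \<open>disturbance_set P\<close> is compact. Moving a relaxed feasible control towards it by a
    fraction \<open>\<delta> / (\<rho> + \<delta>)\<close> compensates a displacement \<open>\<delta>\<close> of the terminal state caused by a change of
    the samples, and by convexity it costs at most a multiple of \<open>\<delta>\<close>. Hence \<open>G\<close> is Lipschitz on the
    compact sample set and attains its maximum
    (\<open>relaxed_feasible_perturbation\<close>, \<open>continuous_on_G\<close>).

  \<^item> Equality of values. Let \<open>c\<close> be the maximum of \<open>G\<close>. Any \<open>N\<close> scenario sets have a common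
    point in the sublevel set \<open>{f \<le> c}\<close> of the objective, and all scenario sets contain the strictly
    feasible control. So any \<open>N + 1\<close> members of the family formed by the scenario sets and \<open>{f \<le> c}\<close> have a
    common point, and Helly's theorem in dimension \<open>N\<close> with compactness gives a robust feasible control of
    cost at most \<open>c\<close> (\<open>Helly_convex_program\<close>, \<open>V_eq_G_arg_max\<close>). That the sublevel set is
    a member of the family is the reason why \<open>N\<close> scenarios suffice instead of \<open>N + 1\<close>.

  \<^item> Convergence. The robust minimizer is feasible for the optimal relaxed program and has the same value,
    so by strict convexity it is the minimizer of the relaxed program. The limit \<open>\<epsilon> \<down> 0\<close> is thus that of
    a Tikhonov regularization on a fixed compact convex set, and the minimizers converge to the
    robust \<open>J\<close>-optimal control with the least \<open>R\<close> (\<open>regularized_minimizers_converge\<close>).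
\<close>

section \<open>Bounded families of functionals\<close>

text \<open>The vectors \<open>v\<close> for which \<open>\<theta> \<mapsto> \<theta> \<bullet> v\<close> is bounded on the set form a subspace. It contains \<open>S\<close>,
  hence every basis vector.\<close>

lemma bounded_if_span_UNIV:
  fixes S :: "'a::euclidean_space set"
  assumes "span S = UNIV"
  shows "bounded {\<theta>. \<forall>s\<in>S. \<bar>\<theta> \<bullet> s\<bar> \<le> r}" (is "bounded ?A")
proof -
  have "\<exists>C. \<forall>\<theta>\<in>?A. \<bar>\<theta> \<bullet> v\<bar> \<le> C" for v
  proof -
    have "v \<in> span S" using assms by simp
    then show ?thesis
    proof (induction rule: span_induct)
      case base
      show ?case
      proof (rule subspaceI)
        show "0 \<in> {v. \<exists>C. \<forall>\<theta>\<in>?A. \<bar>\<theta> \<bullet> v\<bar> \<le> C}" by (auto intro: exI[of _ 0])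
      next
        fix x y assume "x \<in> {v. \<exists>C. \<forall>\<theta>\<in>?A. \<bar>\<theta> \<bullet> v\<bar> \<le> C}" "y \<in> {v. \<exists>C. \<forall>\<theta>\<in>?A. \<bar>\<theta> \<bullet> v\<bar> \<le> C}"
        then obtain C D where "\<forall>\<theta>\<in>?A. \<bar>\<theta> \<bullet> x\<bar> \<le> C" "\<forall>\<theta>\<in>?A. \<bar>\<theta> \<bullet> y\<bar> \<le> D" by blast
        then have "\<forall>\<theta>\<in>?A. \<bar>\<theta> \<bullet> (x + y)\<bar> \<le> C + D"
          by (fastforce simp: inner_add_right)
        then show "x + y \<in> {v. \<exists>C. \<forall>\<theta>\<in>?A. \<bar>\<theta> \<bullet> v\<bar> \<le> C}" by blast
      next
        fix c x assume "x \<in> {v. \<exists>C. \<forall>\<theta>\<in>?A. \<bar>\<theta> \<bullet> v\<bar> \<le> C}"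
        then obtain C where "\<forall>\<theta>\<in>?A. \<bar>\<theta> \<bullet> x\<bar> \<le> C" by blast
        then have "\<forall>\<theta>\<in>?A. \<bar>\<theta> \<bullet> (c *\<^sub>R x)\<bar> \<le> \<bar>c\<bar> * C"
          by (simp add: abs_mult mult_left_mono)
        then show "c *\<^sub>R x \<in> {v. \<exists>C. \<forall>\<theta>\<in>?A. \<bar>\<theta> \<bullet> v\<bar> \<le> C}" by blast
      qed
    next
      case (step s)
      then show ?case by blast
    qed
  qed
  then have "\<forall>v. \<exists>C. \<forall>\<theta>\<in>?A. \<bar>\<theta> \<bullet> v\<bar> \<le> C" by (rule allI)
  then obtain C where C: "\<forall>v. \<forall>\<theta>\<in>?A. \<bar>\<theta> \<bullet> v\<bar> \<le> C v"
    by (rule choice[THEN exE])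
  have "norm \<theta> \<le> (\<Sum>b\<in>Basis. C b)" if "\<theta> \<in> ?A" for \<theta>
  proof -
    have "\<bar>\<theta> \<bullet> b\<bar> \<le> C b" for b using C that by blast
    then have "(\<Sum>b\<in>Basis. \<bar>\<theta> \<bullet> b\<bar>) \<le> (\<Sum>b\<in>Basis. C b)" by (rule sum_mono)
    with norm_le_l1[of \<theta>] show ?thesis by linarith
  qed
  then show ?thesis by (rule boundedI)
qed

text \<open>If the coordinate functions of \<open>g\<close> are linearly independent on \<open>I\<close>, then no nonzero vector is
  orthogonal to all values of \<open>g\<close>. This is how independent basis functions make the admissible
  coefficient sets bounded.\<close>

lemma span_range_eq_UNIV:
  fixes g :: "'b \<Rightarrow> 'a::euclidean_space"
  assumes "\<And>c. (\<And>t. t \<in> I \<Longrightarrow> c \<bullet> g t = 0) \<Longrightarrow> c = 0"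
  shows "span (g ` I) = UNIV"
proof (rule ccontr)
  assume "span (g ` I) \<noteq> UNIV"
  then have "dim (g ` I) < DIM('a)"
    using dim_eq_full dim_subset_UNIV nless_le by blast
  then obtain c where c: "c \<noteq> 0" "\<And>y. y \<in> span (g ` I) \<Longrightarrow> orthogonal c y"
    using orthogonal_to_subspace_exists by blast
  have "c \<bullet> g t = 0" if "t \<in> I" for t
    using c(2)[OF span_base, of "g t"] that by (simp add: orthogonal_def)
  with assms c(1) show False by blast
qed

lemma bounded_vec_components:
  fixes S :: "'a::real_normed_vector set"
  assumes "bounded S"
  shows "bounded {v :: 'a^'k. \<forall>i. v $ i \<in> S}"
proof -
  obtain C where C: "\<And>y. y \<in> S \<Longrightarrow> norm y \<le> C" using assms by (auto simp: bounded_iff)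
  have "norm v \<le> (\<Sum>i\<in>(UNIV :: 'k set). C)" if "\<And>i. v $ i \<in> S" for v :: "'a^'k"
  proof -
    have "norm v \<le> (\<Sum>i\<in>UNIV. norm (v $ i))"
      unfolding norm_vec_def by (rule L2_set_le_sum) simp
    also have "\<dots> \<le> (\<Sum>i\<in>(UNIV :: 'k set). C)" by (intro sum_mono C that)
    finally show ?thesis .
  qed
  then show ?thesis by (auto simp: bounded_iff)
qed

lemma compact_vec_components:
  fixes S :: "'a::euclidean_space set"
  assumes "compact S"
  shows "compact {v :: 'a^'k. \<forall>i. v $ i \<in> S}"
proof -
  have "closed ((\<lambda>v :: 'a^'k. v $ i) -` S)" for i
    using assms by (intro closed_vimage compact_imp_closed continuous_intros)
  moreover have "{v :: 'a^'k. \<forall>i. v $ i \<in> S} = (\<Inter>i. (\<lambda>v. v $ i) -` S)" by auto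
  ultimately have "closed {v :: 'a^'k. \<forall>i. v $ i \<in> S}" by (simp add: closed_INT)
  then show ?thesis
    using bounded_vec_components[OF compact_imp_bounded[OF assms]]
    by (simp add: compact_eq_bounded_closed)
qed

section \<open>Convex programs\<close>

lemma convex_on_sublevel:
  assumes "convex_on S f"
  shows "convex {x \<in> S. f x \<le> c}"
proof (rule convexI)
  fix x y and u v :: real
  assume xy: "x \<in> {x \<in> S. f x \<le> c}" "y \<in> {x \<in> S. f x \<le> c}" and uv: "0 \<le> u" "0 \<le> v" "u + v = 1"
  have "f (u *\<^sub>R x + v *\<^sub>R y) \<le> u * f x + v * f y"
    using assms xy uv by (simp add: convex_on_def)
  also have "\<dots> \<le> u * c + v * c"
    using xy uv by (intro add_mono mult_left_mono) auto
  also have "\<dots> = c" using uv by (metis distrib_right mult_1)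
  finally show "u *\<^sub>R x + v *\<^sub>R y \<in> {x \<in> S. f x \<le> c}"
    using convexD[of S x y u v] assms xy uv by (simp add: convex_on_def)
qed

text \<open>Let \<open>n\<close> be the dimension. In a feasible convex program whose subprograms with at most \<open>n\<close>
  constraints have values at most \<open>c\<close>, the whole program has value at most \<open>c\<close>. Helly's theorem is
  applied to the constraint sets together with the sublevel set of the objective: \<open>n + 1\<close> members
  that include the sublevel set contain only \<open>n\<close> constraints, and \<open>n + 1\<close> constraint sets share
  the feasible point \<open>p\<close>.\<close>

lemma Helly_convex_program:
  fixes C :: "'i \<Rightarrow> 'a::euclidean_space set" and f :: "'a \<Rightarrow> real"
  assumes compact: "\<And>i. i \<in> I \<Longrightarrow> compact (C i)"
    and convex: "\<And>i. i \<in> I \<Longrightarrow> convex (C i)"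
    and f: "convex_on UNIV f"
    and p: "\<And>i. i \<in> I \<Longrightarrow> p \<in> C i"
    and "I \<noteq> {}"
    and sub: "\<And>I'. finite I' \<Longrightarrow> I' \<subseteq> I \<Longrightarrow> I' \<noteq> {} \<Longrightarrow> card I' \<le> DIM('a) \<Longrightarrow>
      \<exists>\<theta>\<in>(\<Inter>i\<in>I'. C i). f \<theta> \<le> c"
  shows "\<exists>\<theta>\<in>(\<Inter>i\<in>I. C i). f \<theta> \<le> c"
proof -
  define S where "S = {\<theta>. f \<theta> \<le> c}"
  have "convex S" using convex_on_sublevel[OF f, of c] by (simp add: S_def)
  have "closed S"
    using continuous_closed_preimage[OF convex_on_continuous[OF open_UNIV f], of "{..c}"]
    by (simp add: S_def vimage_def)
  obtain i0 where i0: "i0 \<in> I" using \<open>I \<noteq> {}\<close> by blast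
  have few: "S \<inter> \<Inter>\<T> \<noteq> {}" if "finite \<T>" "\<T> \<subseteq> C ` I" "card \<T> \<le> DIM('a)" for \<T>
  proof -
    obtain U where U: "U \<subseteq> I" "inj_on C U" "\<T> = C ` U"
      using \<open>\<T> \<subseteq> C ` I\<close> by (auto simp: subset_image_inj)
    have fin: "finite U" "card U \<le> DIM('a)"
      using U that finite_image_iff card_image by metis+
    show ?thesis
    proof (cases "U = {}")
      case True
      \<comment> \<open>The empty subfamily is covered by the bound for a single constraint.\<close>
      have "1 \<le> DIM('a)" using DIM_positive[where 'a = 'a] by linarith
      then show ?thesis using sub[of "{i0}"] i0 U True by (auto simp: S_def)
    next
      case False
      then show ?thesis using sub[OF fin(1) U(1) False fin(2)] U(3) by (auto simp: S_def)
    qed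
  qed
  have "(C i0 \<inter> S) \<inter> (\<Inter>i\<in>I. C i) \<noteq> {}"
  proof (rule compact_imp_fip_image)
    show "compact (C i0 \<inter> S)"
      using compact[OF i0] \<open>closed S\<close> by (rule compact_Int_closed)
  next
    fix I' assume I': "finite I'" "I' \<subseteq> I"
    define F where "F = insert S (C ` insert i0 I')"
    have F: "finite F" "F - {S} \<subseteq> C ` I" using I' i0 by (auto simp: F_def)
    have "\<Inter>F \<noteq> {}"
    proof (cases "card F \<le> DIM('a)")
      case True
      then have "card (C ` insert i0 I') \<le> DIM('a)"
        using card_mono[OF F(1), of "C ` insert i0 I'"] by (simp add: F_def subset_insertI)
      then show ?thesis
        using few[of "C ` insert i0 I'"] I' i0 by (auto simp: F_def)
    next
      case False
      show ?thesis
      proof (rule Helly)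
        show "card F \<ge> DIM('a) + 1" using False by simp
        show "\<forall>s\<in>F. convex s" using convex \<open>convex S\<close> i0 I' by (auto simp: F_def)
      next
        fix t assume t: "t \<subseteq> F" "card t = DIM('a) + 1"
        show "\<Inter>t \<noteq> {}"
        proof (cases "S \<in> t")
          case True
          have "finite t" using t(1) F(1) by (rule finite_subset)
          then have "card (t - {S}) \<le> DIM('a)" using True t(2) by simp
          then have "S \<inter> \<Inter>(t - {S}) \<noteq> {}"
            using few[of "t - {S}"] \<open>finite t\<close> t(1) F(2) by blast
          then show ?thesis using True by auto
        next
          case False
          then have "t \<subseteq> C ` I" using t(1) F(2) by blast
          then have "p \<in> \<Inter>t" using p by auto
          then show ?thesis by blast
        qed
      qed
    qed
    then show "(C i0 \<inter> S) \<inter> (\<Inter>i\<in>I'. C i) \<noteq> {}"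
      by (auto simp: F_def)
  qed (use compact compact_imp_closed in blast)
  then show ?thesis by (auto simp: S_def)
qed

lemma compact_is_arg_min_exists:
  fixes f :: "'a::topological_space \<Rightarrow> real"
  assumes "compact S" "S \<noteq> {}" "continuous_on S f"
  shows "\<exists>\<theta>. is_arg_min f (\<lambda>\<theta>. \<theta> \<in> S) \<theta>"
  using continuous_attains_inf[OF assms] by (auto simp: is_arg_min_linorder)

lemma INF_ereal_is_arg_min:
  assumes "is_arg_min f (\<lambda>\<theta>. \<theta> \<in> S) \<theta>"
  shows "(INF \<theta>\<in>S. ereal (f \<theta>)) = ereal (f \<theta>)"
  using assms by (intro antisym INF_lower INF_greatest) (auto simp: is_arg_min_linorder)

lemma strictly_convex_on_imp_convex_on:
  "strictly_convex_on S f \<Longrightarrow> convex_on S f"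
proof (rule convex_onI)
  fix t :: real and x y
  assume "strictly_convex_on S f" "0 < t" "t < 1" "x \<in> S" "y \<in> S"
  then show "f ((1 - t) *\<^sub>R x + t *\<^sub>R y) \<le> (1 - t) * f x + t * f y"
    by (cases "x = y") (auto simp: strictly_convex_on_def scaleR_left_distrib[symmetric]
        algebra_simps intro!: less_imp_le)
qed (simp add: strictly_convex_on_def)

lemma strictly_convex_on_add_scale:
  assumes "convex_on S f" "strictly_convex_on S g" "0 < c"
  shows "strictly_convex_on S (\<lambda>x. f x + c * g x)"
  unfolding strictly_convex_on_def
proof safe
  show "convex S" using assms(2) by (simp add: strictly_convex_on_def)
  fix x y and s :: real
  assume xy: "x \<in> S" "y \<in> S" "x \<noteq> y" "0 < s" "s < 1"
  have "f ((1 - s) *\<^sub>R x + s *\<^sub>R y) \<le> (1 - s) * f x + s * f y"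
    using convex_onD[OF assms(1)] xy by simp
  moreover have "c * g ((1 - s) *\<^sub>R x + s *\<^sub>R y) < c * ((1 - s) * g x + s * g y)"
    using assms(2,3) xy by (simp add: strictly_convex_on_def)
  ultimately show "f ((1 - s) *\<^sub>R x + s *\<^sub>R y) + c * g ((1 - s) *\<^sub>R x + s *\<^sub>R y)
      < (1 - s) * (f x + c * g x) + s * (f y + c * g y)"
    by (simp add: algebra_simps)
qed

text \<open>The midpoint of two distinct minimizers would have a smaller value.\<close>

lemma strictly_convex_arg_min_unique:
  assumes f: "strictly_convex_on UNIV f" and S: "convex S"
    and x: "is_arg_min f (\<lambda>\<theta>. \<theta> \<in> S) x" and y: "is_arg_min f (\<lambda>\<theta>. \<theta> \<in> S) y"
  shows "x = y"
proof (rule ccontr)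
  assume "x \<noteq> y"
  define m where "m = (1 - 1/2) *\<^sub>R x + (1/2::real) *\<^sub>R y"
  have "m \<in> S" unfolding m_def
    by (rule convexD_alt[OF S]) (use x y in \<open>auto simp: is_arg_min_linorder\<close>)
  have "f m < (1 - 1/2) * f x + (1/2) * f y"
    unfolding m_def by (rule f[unfolded strictly_convex_on_def, THEN conjunct2, rule_format])
      (use \<open>x \<noteq> y\<close> in auto)
  moreover have "f x \<le> f m" "f y \<le> f m"
    using x y \<open>m \<in> S\<close> by (auto simp: is_arg_min_linorder)
  ultimately show False by simp
qed

text \<open>Tikhonov regularization. The limit \<open>\<theta>0\<close> minimizes \<open>R\<close> among the minimizers of \<open>f\<close>; it is unique by
  strict convexity. Comparing \<open>\<theta> \<epsilon>\<close> with \<open>\<theta>0\<close> gives \<open>R (\<theta> \<epsilon>) \<le> R \<theta>0\<close> and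
  \<open>f (\<theta> \<epsilon>) \<le> f \<theta>0 + \<epsilon> * R \<theta>0\<close>, so only points near \<open>\<theta>0\<close> qualify when \<open>\<epsilon>\<close> is small.\<close>

lemma regularized_minimizers_converge:
  fixes f R :: "'a::euclidean_space \<Rightarrow> real"
  assumes S: "compact S" "convex S" "S \<noteq> {}"
    and f: "convex_on UNIV f"
    and R: "strictly_convex_on UNIV R" "\<And>\<theta>. 0 < R \<theta>"
    and \<theta>: "\<And>\<epsilon>. 0 < \<epsilon> \<Longrightarrow> is_arg_min (\<lambda>\<theta>. f \<theta> + \<epsilon> * R \<theta>) (\<lambda>\<theta>. \<theta> \<in> S) (\<theta> \<epsilon>)"
  shows "\<exists>\<theta>0. is_arg_min f (\<lambda>\<theta>. \<theta> \<in> S) \<theta>0 \<and> (\<theta> \<longlongrightarrow> \<theta>0) (at_right 0)"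
proof -
  have cont: "continuous_on A f" "continuous_on A R" for A
    using convex_on_continuous[OF open_UNIV f]
      convex_on_continuous[OF open_UNIV strictly_convex_on_imp_convex_on[OF R(1)]]
      continuous_on_subset by blast+
  obtain \<theta>1 where \<theta>1: "is_arg_min f (\<lambda>\<theta>. \<theta> \<in> S) \<theta>1"
    using compact_is_arg_min_exists[OF S(1,3) cont(1)] by blast
  define M where "M = {\<theta>\<in>S. f \<theta> \<le> f \<theta>1}"
  have M_eq: "M = S \<inter> {\<theta>. f \<theta> \<le> f \<theta>1}" by (auto simp: M_def)
  have "compact M" unfolding M_eq
    using S(1) continuous_closed_preimage[OF cont(1) closed_UNIV, of "{..f \<theta>1}"]
    by (intro compact_Int_closed) (simp_all add: vimage_def)
  moreover have "M \<noteq> {}" using \<theta>1 by (auto simp: M_def is_arg_min_linorder)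
  ultimately obtain \<theta>0 where \<theta>0: "is_arg_min R (\<lambda>\<theta>. \<theta> \<in> M) \<theta>0"
    using compact_is_arg_min_exists cont(2) by blast
  have min0: "is_arg_min f (\<lambda>\<theta>. \<theta> \<in> S) \<theta>0"
    using \<theta>0 \<theta>1 by (fastforce simp: is_arg_min_linorder M_def)
  have convM: "convex M" unfolding M_def
    using convex_on_subset[OF f subset_UNIV S(2)] by (rule convex_on_sublevel)
  \<comment> \<open>\<open>g\<close> measures the failure to be \<open>\<theta>0\<close>: on \<open>S\<close> it is positive elsewhere, hence bounded away from
    \<open>0\<close> outside each ball around \<open>\<theta>0\<close>.\<close>
  define g where "g = (\<lambda>\<theta>. max (f \<theta> - f \<theta>0) (R \<theta> - R \<theta>0))"
  have g_pos: "0 < g \<theta>'" if "\<theta>' \<in> S" "\<theta>' \<noteq> \<theta>0" for \<theta>'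
  proof (rule ccontr)
    assume "\<not> 0 < g \<theta>'"
    then have le: "f \<theta>' \<le> f \<theta>0" "R \<theta>' \<le> R \<theta>0" by (auto simp: g_def max_def split: if_splits)
    then have "\<theta>' \<in> M" using that \<theta>0 by (auto simp: M_def is_arg_min_linorder)
    with le \<theta>0 have "is_arg_min R (\<lambda>\<theta>. \<theta> \<in> M) \<theta>'"
      by (force simp: is_arg_min_linorder)
    with \<theta>0 R(1) convM that(2) show False
      using strictly_convex_arg_min_unique by blast
  qed
  have g_le: "g (\<theta> \<epsilon>) \<le> \<epsilon> * R \<theta>0" if "0 < \<epsilon>" for \<epsilon>
  proof -
    have "\<theta>0 \<in> S" using min0 by (simp add: is_arg_min_linorder)
    then have 1: "f (\<theta> \<epsilon>) + \<epsilon> * R (\<theta> \<epsilon>) \<le> f \<theta>0 + \<epsilon> * R \<theta>0"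
      using \<theta>[OF that] by (simp add: is_arg_min_linorder)
    have 2: "f \<theta>0 \<le> f (\<theta> \<epsilon>)"
      using min0 \<theta>[OF that] by (simp add: is_arg_min_linorder)
    have pos: "0 < \<epsilon> * R (\<theta> \<epsilon>)" "0 < \<epsilon> * R \<theta>0" using R(2) that by simp_all
    have "\<epsilon> * R (\<theta> \<epsilon>) \<le> \<epsilon> * R \<theta>0" using 1 2 by linarith
    then have "R (\<theta> \<epsilon>) \<le> R \<theta>0" using that by simp
    then show ?thesis using 1 pos by (simp add: g_def)
  qed
  have "(\<theta> \<longlongrightarrow> \<theta>0) (at_right 0)"
  proof (rule tendstoI)
    fix \<delta> :: real assume "0 < \<delta>"
    define K where "K = S - ball \<theta>0 \<delta>"
    have "compact K" unfolding K_def using S(1) by (intro compact_diff) auto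
    have "\<exists>\<mu>>0. \<forall>\<theta>'\<in>K. \<mu> \<le> g \<theta>'"
    proof (cases "K = {}")
      case True
      then show ?thesis by (intro exI[of _ 1]) simp
    next
      case False
      have "continuous_on K g" unfolding g_def
        by (intro continuous_on_max continuous_on_diff cont continuous_on_const)
      then obtain k where k: "k \<in> K" "\<forall>\<theta>'\<in>K. g k \<le> g \<theta>'"
        using continuous_attains_inf[OF \<open>compact K\<close> False] by blast
      have "0 < g k" using k(1) \<open>0 < \<delta>\<close> by (intro g_pos) (auto simp: K_def)
      with k(2) show ?thesis by blast
    qed
    then obtain \<mu> where \<mu>: "0 < \<mu>" "\<And>\<theta>'. \<theta>' \<in> K \<Longrightarrow> \<mu> \<le> g \<theta>'" by blast
    have "0 < \<mu> / R \<theta>0" using \<mu>(1) R(2) by simp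
    then show "\<forall>\<^sub>F \<epsilon> in at_right 0. dist (\<theta> \<epsilon>) \<theta>0 < \<delta>"
      unfolding eventually_at_right_field
    proof (intro exI[of _ "\<mu> / R \<theta>0"] conjI allI impI)
      fix \<epsilon> :: real assume \<epsilon>: "0 < \<epsilon>" "\<epsilon> < \<mu> / R \<theta>0"
      have "\<epsilon> * R \<theta>0 < \<mu>" using \<epsilon>(2) R(2)[of \<theta>0] by (simp add: field_simps)
      then have "\<theta> \<epsilon> \<notin> K" using g_le[OF \<epsilon>(1)] \<mu>(2)[of "\<theta> \<epsilon>"] by linarith
      then show "dist (\<theta> \<epsilon>) \<theta>0 < \<delta>"
        using \<theta>[OF \<epsilon>(1)] by (simp add: K_def is_arg_min_linorder dist_commute)
    qed
  qed
  with min0 show ?thesis by blast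
qed

text \<open>The error term \<open>(1 - s) *\<^sub>R e\<close> can be charged to the second point, where it becomes
  \<open>((1 - s) / s) *\<^sub>R e\<close>. The value of \<open>s\<close> is the one for which this has norm at most \<open>\<rho>\<close>.\<close>

lemma convex_shrink_absorbs_error:
  fixes X :: "'a::real_normed_vector set"
  assumes X: "convex X" "x \<in> X" "cball y \<rho> \<subseteq> X" and "norm e \<le> \<delta>" "0 < \<rho>" "0 \<le> \<delta>"
    and s: "s = \<delta> / (\<rho> + \<delta>)"
  shows "(1 - s) *\<^sub>R (x + e) + s *\<^sub>R y \<in> X"
proof (cases "\<delta> = 0")
  case True
  then show ?thesis using assms by simp
next
  case False
  then have \<delta>: "0 < \<delta>" using assms by simp
  have s01: "0 < s" "s \<le> 1" and s': "(1 - s) * \<delta> = s * \<rho>"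
    using \<delta> \<open>0 < \<rho>\<close> by (auto simp: s field_simps)
  define y' where "y' = y + ((1 - s) / s) *\<^sub>R e"
  have "norm (((1 - s) / s) *\<^sub>R e) \<le> (1 - s) / s * \<delta>"
    using assms(4) s01 by (simp add: mult_left_mono divide_right_mono)
  also have "\<dots> = \<rho>" using s' s01 by (simp add: field_simps)
  finally have "y' \<in> X" using X(3) by (auto simp: y'_def dist_norm)
  then have "(1 - s) *\<^sub>R x + s *\<^sub>R y' \<in> X"
    using convexD_alt[OF X(1,2)] s01 by simp
  also have "(1 - s) *\<^sub>R x + s *\<^sub>R y' = (1 - s) *\<^sub>R (x + e) + s *\<^sub>R y"
    using s01 by (simp add: y'_def scaleR_add_right)
  finally show ?thesis .
qed

section \<open>The state as an affine function of control and disturbance\<close>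

lemma PC_abs: "y \<in> PC h K T \<Longrightarrow> (\<lambda>t. \<bar>y t\<bar>) \<in> PC h K T"
  unfolding PC_def constant_on_def by simp metis

text \<open>One problem instance with initial state \<open>x\<close>. Strict feasibility is what makes the feasible sets stable
  under changes of the disturbance.\<close>

locale robust_attention =
  fixes P :: "('d::finite, 'n::finite, 'm::finite) attention_problem"
    and h :: real and K :: nat and x :: "real^'d"
  assumes XF: "compact (XF P)" "convex (XF P)"
    and partition: "0 < h" "real K * h \<le> horizon P"
    and Psi_PC: "\<And>i. (\<lambda>t. Psi P t $ i) \<in> PC h K (horizon P)"
    and Psi_indep: "\<And>c. (\<And>t. t \<in> {0..horizon P} \<Longrightarrow> (\<Sum>i\<in>UNIV. c i * Psi P t $ i) = 0) \<Longrightarrow> \<forall>i. c i = 0"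
    and Phi_PC: "\<And>j. (\<lambda>t. Phi P t $ j) \<in> PC h K (horizon P)"
    and Phi_indep: "\<And>c. (\<And>t. t \<in> {0..horizon P} \<Longrightarrow> (\<Sum>j\<in>UNIV. c j * Phi P t $ j) = 0) \<Longrightarrow> \<forall>j. c j = 0"
    and wbar_pos: "\<And>j. 0 < wbar P $ j"
    and reg: "\<And>\<Theta>. 0 < reg P \<Theta>" "strictly_convex_on UNIV (reg P)"
    and slater: "strictly_feasible P x"
begin

abbreviation (input) T where "T \<equiv> horizon P"

lemma T_nonneg: "0 \<le> T"
proof -
  have "0 \<le> real K * h" using partition(1) by simp
  then show ?thesis using partition(2) by linarith
qed

definition forcing :: "real^'n \<Rightarrow> real^'m^'d \<Rightarrow> real \<Rightarrow> real^('d + unit)"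
  where "forcing \<Theta> \<beta> \<tau> = mat_exp ((T - \<tau>) *\<^sub>R Abar P) *v
    ((\<Theta> \<bullet> Psi P \<tau>) *\<^sub>R Bbar + cbar *v (\<beta> *v Phi P \<tau>))"

lemma inner_Psi_PC: "(\<lambda>\<tau>. \<Theta> \<bullet> Psi P \<tau>) \<in> PC h K T"
  by (simp add: inner_vec_def PC_sum PC_scale Psi_PC)

text \<open>Column by column, the integrand is a piecewise constant function times a continuous one.\<close>

lemma forcing_integrable: "forcing \<Theta> \<beta> integrable_on {0..T}"
proof -
  let ?E = "\<lambda>\<tau>. mat_exp ((T - \<tau>) *\<^sub>R Abar P)"
  let ?g = "\<lambda>\<tau>. (\<Theta> \<bullet> Psi P \<tau>) *\<^sub>R Bbar + cbar *v (\<beta> *v Phi P \<tau>) :: real^('d + unit)"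
  have g: "(\<lambda>\<tau>. ?g \<tau> $ i) \<in> PC h K T" for i
  proof (cases i)
    case (Inl i')
    then have "(\<lambda>\<tau>. ?g \<tau> $ i) = (\<lambda>\<tau>. \<Sum>j\<in>UNIV. \<beta> $ i' $ j * Phi P \<tau> $ j)"
      by (simp add: Bbar_def cbar_def matrix_vector_mult_def if_distrib[where f = "\<lambda>x. x * _"]
          cong: if_cong)
    then show ?thesis by (simp add: PC_sum PC_scale Phi_PC)
  next
    case (Inr u)
    then have "(\<lambda>\<tau>. ?g \<tau> $ i) = (\<lambda>\<tau>. \<Theta> \<bullet> Psi P \<tau>)"
      by (simp add: Bbar_def cbar_def matrix_vector_mult_def)
    then show ?thesis by (simp add: inner_Psi_PC)
  qed
  have "continuous_on {0..T} ?E"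
    by (rule continuous_on_compose2[OF continuous_on_mat_exp_scaleR[of 0 T]])
      (auto intro!: continuous_intros)
  then have "continuous_on {0..T} (\<lambda>\<tau>. column i (?E \<tau>))" for i
    unfolding column_def by (intro continuous_intros)
  then have "(\<lambda>\<tau>. \<Sum>i\<in>UNIV. (?g \<tau> $ i) *\<^sub>R column i (?E \<tau>)) integrable_on {0..T}"
    by (intro integrable_sum PC_scaleR_integrable[OF g partition]) auto
  then show ?thesis
    by (simp only: forcing_def[abs_def] matrix_mult_sum scalar_mult_eq_scaleR)
qed

text \<open>The part of the terminal state \<open>z(T)\<close> that is caused by the control and the disturbance.\<close>

definition response :: "(real^'n) \<times> (real^'m^'d) \<Rightarrow> real^('d + unit)"
  where "response p = integral {0..T} (forcing (fst p) (snd p))"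

lemma linear_response: "linear response"
proof (rule linearI)
  fix p q :: "(real^'n) \<times> (real^'m^'d)" and c :: real
  have "forcing (fst (p + q)) (snd (p + q)) = (\<lambda>\<tau>. forcing (fst p) (snd p) \<tau> + forcing (fst q) (snd q) \<tau>)"
    by (simp add: fun_eq_iff forcing_def inner_add_left scaleR_add_left
        matrix_vector_mult_add_rdistrib matrix_vector_right_distrib)
  then show "response (p + q) = response p + response q"
    by (simp add: response_def integral_add forcing_integrable)
  have "forcing (fst (c *\<^sub>R p)) (snd (c *\<^sub>R p)) = (\<lambda>\<tau>. c *\<^sub>R forcing (fst p) (snd p) \<tau>)"
  proof
    fix \<tau>
    have "(c *\<^sub>R snd p) *v Phi P \<tau> = c *\<^sub>R (snd p *v Phi P \<tau>)"
      by (rule scaleR_matrix_vector_assoc[symmetric])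
    then show "forcing (fst (c *\<^sub>R p)) (snd (c *\<^sub>R p)) \<tau> = c *\<^sub>R forcing (fst p) (snd p) \<tau>"
      by (simp add: forcing_def matrix_vector_mult_scaleR flip: scaleR_add_right scaleR_scaleR)
  qed
  then show "response (c *\<^sub>R p) = c *\<^sub>R response p"
    by (simp add: response_def)
qed

lemma z_eq_response: "z P x \<Theta> \<beta> T = mat_exp (T *\<^sub>R Abar P) *v init P x + response (\<Theta>, \<beta>)"
  by (simp add: z_def response_def forcing_def[abs_def])

lemma z_diff: "z P x \<Theta> \<beta> T - z P x \<Theta>' \<beta>' T = response (\<Theta> - \<Theta>', \<beta> - \<beta>')"
  using linear_diff[OF linear_response, of "(\<Theta>, \<beta>)" "(\<Theta>', \<beta>')"] by (simp add: z_eq_response)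

lemma continuous_on_z:
  assumes "continuous_on S f" "continuous_on S g"
  shows "continuous_on S (\<lambda>y. z P x (f y) (g y) T)"
proof -
  have "continuous_on UNIV response"
    using linear_response by (simp add: linear_continuous_on linear_conv_bounded_linear)
  then have "continuous_on S (\<lambda>y. response (f y, g y))"
    by (rule continuous_on_compose2) (simp_all add: assms continuous_on_Pair)
  then show ?thesis
    unfolding z_eq_response by (rule continuous_on_add[OF continuous_on_const])
qed

lemma continuous_on_z1:
  assumes "continuous_on S f" "continuous_on S g"
  shows "continuous_on S (\<lambda>y. z1 P x (f y) (g y) T)"
  unfolding z1_def
  by (rule continuous_on_vec_lambda, rule continuous_on_component, rule continuous_on_z[OF assms])

lemma z_affine:
  "z P x ((1 - s) *\<^sub>R \<Theta> + s *\<^sub>R \<Theta>') \<beta> T = (1 - s) *\<^sub>R z P x \<Theta> \<beta> T + s *\<^sub>R z P x \<Theta>' \<beta> T"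
proof -
  have "((1 - s) *\<^sub>R \<Theta> + s *\<^sub>R \<Theta>', \<beta>) = (1 - s) *\<^sub>R (\<Theta>, \<beta>) + s *\<^sub>R (\<Theta>', \<beta>)"
    by (simp flip: scaleR_add_left)
  then have "response ((1 - s) *\<^sub>R \<Theta> + s *\<^sub>R \<Theta>', \<beta>) = (1 - s) *\<^sub>R response (\<Theta>, \<beta>) + s *\<^sub>R response (\<Theta>', \<beta>)"
    by (simp only: linear_add[OF linear_response] linear_cmul[OF linear_response])
  then show ?thesis
    by (simp add: z_eq_response scaleR_add_right algebra_simps)
qed

lemma z1_affine:
  "z1 P x ((1 - s) *\<^sub>R \<Theta> + s *\<^sub>R \<Theta>') \<beta> T = (1 - s) *\<^sub>R z1 P x \<Theta> \<beta> T + s *\<^sub>R z1 P x \<Theta>' \<beta> T"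
  by (simp add: z1_def z_affine vec_eq_iff)

lemma z2_affine:
  "z2 P x ((1 - s) *\<^sub>R \<Theta> + s *\<^sub>R \<Theta>') T = (1 - s) * z2 P x \<Theta> T + s * z2 P x \<Theta>' T"
  by (simp add: z2_def z_affine)

text \<open>Since \<open>\<Theta>\<close> and \<open>\<beta>\<close> enter additively, the constant \<open>B\<close> does not depend on \<open>\<Theta>\<close>.\<close>

lemma z1_lipschitz_disturbance:
  "\<exists>B>0. \<forall>\<Theta> \<beta> \<beta>'. norm (z1 P x \<Theta> \<beta>' T - z1 P x \<Theta> \<beta> T) \<le> B * norm (\<beta>' - \<beta>)"
proof -
  obtain B where B: "0 < B" "\<And>p. norm (response p) \<le> B * norm p"
    using linear_bounded_pos[OF linear_response] by blast
  have "norm (z1 P x \<Theta> \<beta>' T - z1 P x \<Theta> \<beta> T) \<le> B * norm (\<beta>' - \<beta>)" for \<Theta> \<beta> \<beta>'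
  proof -
    have "z1 P x \<Theta> \<beta>' T - z1 P x \<Theta> \<beta> T = (\<chi> i. response (0, \<beta>' - \<beta>) $ Inl i)"
      using z_diff[of \<Theta> \<beta>' \<Theta> \<beta>] by (simp add: z1_def vec_eq_iff)
    also have "norm \<dots> \<le> norm (response (0, \<beta>' - \<beta>))"
    proof -
      have "(\<Sum>i\<in>UNIV. (response (0, \<beta>' - \<beta>) $ Inl i)\<^sup>2) \<le> (\<Sum>i\<in>UNIV. (response (0, \<beta>' - \<beta>) $ i)\<^sup>2)"
        by (subst sum.reindex[of Inl, unfolded o_def, symmetric]) (auto intro!: sum_mono2)
      then show ?thesis by (simp add: norm_vec_def L2_set_def)
    qed
    also have "\<dots> \<le> B * norm (\<beta>' - \<beta>)" using B(2)[of "(0, \<beta>' - \<beta>)"] by (simp add: norm_Pair)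
    finally show ?thesis .
  qed
  with B(1) show ?thesis by blast
qed

section \<open>Admissible parameters and cost\<close>

lemma control_set_eq: "control_set P = {\<Theta>. \<forall>s\<in>Psi P ` {0..T}. \<bar>\<Theta> \<bullet> s\<bar> \<le> rate P}"
  by (simp add: control_set_def)

lemma compact_control_set: "compact (control_set P)"
proof -
  have "span (Psi P ` {0..T}) = UNIV"
  proof (rule span_range_eq_UNIV)
    fix c assume "\<And>t. t \<in> {0..T} \<Longrightarrow> c \<bullet> Psi P t = 0"
    then show "c = 0" using Psi_indep[of "\<lambda>i. c $ i"] by (simp add: inner_vec_def vec_eq_iff)
  qed
  then have "bounded (control_set P)"
    unfolding control_set_eq by (rule bounded_if_span_UNIV)
  moreover have "closed (control_set P)"
    unfolding control_set_def Ball_def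
    by (intro closed_Collect_all closed_Collect_imp closed_Collect_le continuous_intros) simp
  ultimately show ?thesis by (simp add: compact_eq_bounded_closed)
qed

lemma convex_control_set: "convex (control_set P)"
proof -
  have "control_set P = (\<Inter>t\<in>{0..T}. {\<Theta>. \<bar>Psi P t \<bullet> \<Theta>\<bar> \<le> rate P})"
    unfolding control_set_def inner_commute[of "Psi P _"] by blast
  then show ?thesis by (simp add: convex_INT convex_halfspace_abs_le)
qed

text \<open>Each row of \<open>\<beta>\<close> satisfies a bound of the same kind as \<open>\<Theta>\<close> does in the control set.\<close>

lemma compact_disturbance_set: "compact (disturbance_set P)"
proof -
  define w where "w = (MAX i. wbar P $ i)"
  define A where "A = {\<theta>. \<forall>s\<in>Phi P ` {0..T}. \<bar>\<theta> \<bullet> s\<bar> \<le> w}"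
  have "span (Phi P ` {0..T}) = UNIV"
  proof (rule span_range_eq_UNIV)
    fix c assume "\<And>t. t \<in> {0..T} \<Longrightarrow> c \<bullet> Phi P t = 0"
    then show "c = 0" using Phi_indep[of "\<lambda>i. c $ i"] by (simp add: inner_vec_def vec_eq_iff)
  qed
  then have "bounded A" unfolding A_def by (rule bounded_if_span_UNIV)
  have row: "(\<beta> *v v) $ i = \<beta> $ i \<bullet> v" for \<beta> :: "real^'m^'d" and v i
    by (simp add: matrix_vector_mult_def inner_vec_def)
  have "\<beta> $ i \<in> A" if "\<beta> \<in> disturbance_set P" for \<beta> i
  proof -
    have "\<bar>\<beta> $ i \<bullet> Phi P t\<bar> \<le> w" if "t \<in> {0..T}" for t
    proof -
      have "\<beta> *v Phi P t \<in> cbox (- wbar P) (wbar P)"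
        using \<open>\<beta> \<in> disturbance_set P\<close> that by (simp add: disturbance_set_def)
      then have "- wbar P $ i \<le> (\<beta> *v Phi P t) $ i \<and> (\<beta> *v Phi P t) $ i \<le> wbar P $ i"
        by (simp add: mem_box_cart)
      moreover have "wbar P $ i \<le> w" by (simp add: w_def)
      ultimately show ?thesis unfolding row abs_le_iff by linarith
    qed
    then show ?thesis by (simp add: A_def)
  qed
  then have "bounded (disturbance_set P)"
    by (intro bounded_subset[OF bounded_vec_components[OF \<open>bounded A\<close>]]) auto
  moreover have "closed (disturbance_set P)"
  proof -
    have "continuous_on UNIV (\<lambda>\<beta> :: real^'m^'d. \<beta> *v Phi P t)" for t
      unfolding matrix_vector_mult_def by (intro continuous_intros)
    then have "closed ((\<lambda>\<beta> :: real^'m^'d. \<beta> *v Phi P t) -` cbox (- wbar P) (wbar P))" for t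
      using continuous_closed_vimage[OF closed_cbox]
      by (metis continuous_on_eq_continuous_within UNIV_I)
    moreover have "disturbance_set P = (\<Inter>t\<in>{0..T}. (\<lambda>\<beta>. \<beta> *v Phi P t) -` cbox (- wbar P) (wbar P))"
      by (auto simp: disturbance_set_def)
    ultimately show ?thesis by auto
  qed
  ultimately show ?thesis by (simp add: compact_eq_bounded_closed)
qed

lemma zero_in_disturbance_set: "0 \<in> disturbance_set P"
  by (simp add: disturbance_set_def mem_box_cart less_imp_le[OF wbar_pos])

lemma compact_sample_set: "compact (sample_set P)"
  unfolding sample_set_def
  by (intro compact_Times compact_vec_components compact_disturbance_set compact_Icc)

lemma abs_inner_Psi_integrable: "(\<lambda>t. \<bar>\<Theta> \<bullet> Psi P t\<bar>) integrable_on {0..T}"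
proof -
  have "(\<lambda>t. \<bar>\<Theta> \<bullet> Psi P t\<bar>) \<in> PC h K T"
    using inner_Psi_PC[of \<Theta>] by (rule PC_abs)
  from PC_scaleR_integrable[OF this partition order_refl, of "\<lambda>_. 1::real"]
  show ?thesis by simp
qed

lemma J_nonneg: "0 \<le> J P \<Theta>"
  unfolding J_def by (rule integral_nonneg[OF abs_inner_Psi_integrable]) simp

lemma convex_J: "convex_on UNIV (J P)"
proof (rule convex_onI)
  fix s :: real and \<Theta> \<Theta>' assume s: "0 < s" "s < 1"
  have "J P ((1 - s) *\<^sub>R \<Theta> + s *\<^sub>R \<Theta>')
      \<le> integral {0..T} (\<lambda>t. (1 - s) * \<bar>\<Theta> \<bullet> Psi P t\<bar> + s * \<bar>\<Theta>' \<bullet> Psi P t\<bar>)"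
    unfolding J_def
  proof (intro integral_le integrable_add integrable_on_mult_right abs_inner_Psi_integrable)
    fix t
    show "\<bar>((1 - s) *\<^sub>R \<Theta> + s *\<^sub>R \<Theta>') \<bullet> Psi P t\<bar> \<le> (1 - s) * \<bar>\<Theta> \<bullet> Psi P t\<bar> + s * \<bar>\<Theta>' \<bullet> Psi P t\<bar>"
      using abs_triangle_ineq[of "(1 - s) * (\<Theta> \<bullet> Psi P t)" "s * (\<Theta>' \<bullet> Psi P t)"] s
      by (simp add: inner_add_left abs_mult)
  qed
  also have "\<dots> = (1 - s) * J P \<Theta> + s * J P \<Theta>'"
    unfolding J_def
    by (simp add: integral_add integrable_on_mult_right abs_inner_Psi_integrable)
  finally show "J P ((1 - s) *\<^sub>R \<Theta> + s *\<^sub>R \<Theta>') \<le> (1 - s) * J P \<Theta> + s * J P \<Theta>'" .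
qed simp

section \<open>Feasible sets as intersections of scenario sets\<close>

text \<open>Robust and relaxed feasibility are intersections of these sets, which inherit compactness and
  convexity from them.\<close>

definition scenario_feasible :: "real^'m^'d \<Rightarrow> (real^'n) set"
  where "scenario_feasible \<beta> = {\<Theta> \<in> control_set P. z2 P x \<Theta> T = 0 \<and> z1 P x \<Theta> \<beta> T \<in> XF P}"

text \<open>The rate constraints at the sampled times follow from \<open>\<Theta> \<in> control_set P\<close>.\<close>

lemma relaxed_feasible_eq:
  assumes "q \<in> sample_set P"
  shows "relaxed_feasible P x q = (\<Inter>i. scenario_feasible (snd q $ i))"
  using assms by (auto simp: relaxed_feasible_def scenario_feasible_def sample_set_def control_set_def)

text \<open>The intersection retains the constraints that do not involve \<open>\<beta>\<close> because the disturbance set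
  contains \<open>0\<close>.\<close>

lemma robust_feasible_eq: "robust_feasible P x = (\<Inter>\<beta>\<in>disturbance_set P. scenario_feasible \<beta>)"
  using T_nonneg zero_in_disturbance_set
  by (fastforce simp: robust_feasible_def scenario_feasible_def control_set_def)

lemma compact_scenario_feasible: "compact (scenario_feasible \<beta>)"
proof -
  have "continuous_on UNIV (\<lambda>\<Theta>. z2 P x \<Theta> T)" unfolding z2_def
    by (rule continuous_on_component, rule continuous_on_z[OF continuous_on_id continuous_on_const])
  then have "closed ((\<lambda>\<Theta>. z2 P x \<Theta> T) -` {0})"
    by (intro closed_vimage closed_singleton)
  moreover have "closed ((\<lambda>\<Theta>. z1 P x \<Theta> \<beta> T) -` XF P)"
    by (intro closed_vimage compact_imp_closed XF continuous_on_z1 continuous_on_id continuous_on_const)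
  moreover have "scenario_feasible \<beta> =
      control_set P \<inter> ((\<lambda>\<Theta>. z2 P x \<Theta> T) -` {0} \<inter> (\<lambda>\<Theta>. z1 P x \<Theta> \<beta> T) -` XF P)"
    by (auto simp: scenario_feasible_def)
  ultimately show ?thesis
    by (simp only: compact_Int_closed closed_Int compact_control_set)
qed

lemma convex_scenario_feasible: "convex (scenario_feasible \<beta>)"
  unfolding convex_alt scenario_feasible_def
  using convexD_alt[OF convex_control_set] convexD_alt[OF XF(2)]
  by (simp add: z1_affine z2_affine)

definition objective :: "real \<Rightarrow> real^'n \<Rightarrow> real"
  where "objective \<epsilon> \<Theta> = J P \<Theta> + \<epsilon> * reg P \<Theta>"

lemma objective_nonneg: "0 < \<epsilon> \<Longrightarrow> 0 \<le> objective \<epsilon> \<Theta>"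
  using J_nonneg reg(1) by (simp add: objective_def less_imp_le)

lemma strictly_convex_objective: "0 < \<epsilon> \<Longrightarrow> strictly_convex_on UNIV (objective \<epsilon>)"
  unfolding objective_def[abs_def] using convex_J reg(2) by (rule strictly_convex_on_add_scale)

lemma convex_objective: "0 < \<epsilon> \<Longrightarrow> convex_on UNIV (objective \<epsilon>)"
  by (rule strictly_convex_on_imp_convex_on[OF strictly_convex_objective])

lemma continuous_on_objective: "0 < \<epsilon> \<Longrightarrow> continuous_on S (objective \<epsilon>)"
  using convex_on_continuous[OF open_UNIV convex_objective] continuous_on_subset by blast

text \<open>Strict feasibility holds with one margin \<open>\<rho>\<close> for all disturbances, because the terminal states
  reached from the compact disturbance set form a compact subset of the interior of \<open>XF\<close>.\<close>

lemma uniform_slater: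
  obtains \<Theta> \<rho> where "0 < \<rho>" "\<Theta> \<in> control_set P" "z2 P x \<Theta> T = 0"
    "\<And>\<beta>. \<beta> \<in> disturbance_set P \<Longrightarrow> cball (z1 P x \<Theta> \<beta> T) \<rho> \<subseteq> XF P"
proof -
  obtain \<Theta> where \<Theta>: "\<forall>t\<in>{0..T}. \<bar>\<Theta> \<bullet> Psi P t\<bar> < rate P" "z2 P x \<Theta> T = 0"
    "\<forall>\<beta>\<in>disturbance_set P. z1 P x \<Theta> \<beta> T \<in> interior (XF P)"
    using slater by (auto simp: strictly_feasible_def)
  have "compact ((\<lambda>\<beta>. z1 P x \<Theta> \<beta> T) ` disturbance_set P)"
    by (intro compact_continuous_image compact_disturbance_set continuous_on_z1
        continuous_on_id continuous_on_const)
  moreover have "(\<lambda>\<beta>. z1 P x \<Theta> \<beta> T) ` disturbance_set P \<subseteq> interior (XF P)" using \<Theta>(3) by blast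
  ultimately obtain \<rho> where "0 < \<rho>"
    "(\<Union>y\<in>(\<lambda>\<beta>. z1 P x \<Theta> \<beta> T) ` disturbance_set P. cball y \<rho>) \<subseteq> interior (XF P)"
    using compact_subset_open_imp_cball_epsilon_subset[OF _ open_interior] by metis
  moreover have "\<Theta> \<in> control_set P" using \<Theta>(1) by (simp add: control_set_def less_imp_le)
  ultimately show ?thesis
    using that \<Theta>(2) interior_subset[of "XF P"] by blast
qed

lemma robust_feasible_nonempty: "robust_feasible P x \<noteq> {}"
proof -
  obtain \<Theta> \<rho> where "0 < \<rho>" "\<Theta> \<in> control_set P" "z2 P x \<Theta> T = 0"
    and \<rho>: "\<And>\<beta>. \<beta> \<in> disturbance_set P \<Longrightarrow> cball (z1 P x \<Theta> \<beta> T) \<rho> \<subseteq> XF P"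
    by (rule uniform_slater) blast
  then have "\<Theta> \<in> scenario_feasible \<beta>" if "\<beta> \<in> disturbance_set P" for \<beta>
    using \<rho>[OF that] centre_in_cball[of "z1 P x \<Theta> \<beta> T" \<rho>]
    by (auto simp: scenario_feasible_def)
  then show ?thesis by (auto simp: robust_feasible_eq)
qed

lemma robust_subset_relaxed:
  assumes "q \<in> sample_set P"
  shows "robust_feasible P x \<subseteq> relaxed_feasible P x q"
  using assms by (auto simp: relaxed_feasible_eq robust_feasible_eq sample_set_def)

lemma compact_relaxed_feasible: "q \<in> sample_set P \<Longrightarrow> compact (relaxed_feasible P x q)"
  by (auto simp: relaxed_feasible_eq intro!: compact_Inter compact_scenario_feasible)

lemma convex_relaxed_feasible: "q \<in> sample_set P \<Longrightarrow> convex (relaxed_feasible P x q)"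
  by (simp add: relaxed_feasible_eq convex_INT convex_scenario_feasible)

lemma compact_robust_feasible: "compact (robust_feasible P x)"
  unfolding robust_feasible_eq using zero_in_disturbance_set
  by (auto intro!: compact_Inter compact_scenario_feasible)

lemma convex_robust_feasible: "convex (robust_feasible P x)"
  by (simp add: robust_feasible_eq convex_INT convex_scenario_feasible)

lemma relaxed_minimizer_exists:
  assumes "0 < \<epsilon>" "q \<in> sample_set P"
  shows "\<exists>\<Theta>. is_arg_min (objective \<epsilon>) (\<lambda>\<Theta>. \<Theta> \<in> relaxed_feasible P x q) \<Theta>"
  using compact_relaxed_feasible[OF assms(2)] robust_subset_relaxed[OF assms(2)]
    robust_feasible_nonempty continuous_on_objective[OF assms(1)]
  by (intro compact_is_arg_min_exists) auto

lemma robust_minimizer_exists: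
  assumes "0 < \<epsilon>"
  shows "\<exists>\<Theta>. is_arg_min (objective \<epsilon>) (\<lambda>\<Theta>. \<Theta> \<in> robust_feasible P x) \<Theta>"
  using compact_robust_feasible robust_feasible_nonempty continuous_on_objective[OF assms]
  by (rule compact_is_arg_min_exists)

lemma G_eq_objective:
  assumes "is_arg_min (objective \<epsilon>) (\<lambda>\<Theta>. \<Theta> \<in> relaxed_feasible P x q) \<Theta>"
  shows "G P x \<epsilon> q = ereal (objective \<epsilon> \<Theta>)"
  using INF_ereal_is_arg_min[OF assms] by (simp add: G_def objective_def)

lemma V_eq_objective:
  assumes "is_arg_min (objective \<epsilon>) (\<lambda>\<Theta>. \<Theta> \<in> robust_feasible P x) \<Theta>"
  shows "V P x \<epsilon> = ereal (objective \<epsilon> \<Theta>)"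
  using INF_ereal_is_arg_min[OF assms] by (simp add: V_def objective_def)

section \<open>Dependence of the relaxed program on the samples\<close>

text \<open>A change of the samples from \<open>q\<close> to \<open>q'\<close> moves the terminal states by at most \<open>\<delta> = B * dist q q'\<close>.
  The convex combination with the uniformly strictly feasible control restores feasibility, with
  the weight given by \<open>convex_shrink_absorbs_error\<close>. As \<open>s \<le> \<delta> / \<rho>\<close> and the objective is
  nonnegative, the objective grows by at most \<open>\<delta> / \<rho>\<close> times its value at that control.\<close>

lemma relaxed_feasible_perturbation:
  assumes "0 < \<epsilon>"
  shows "\<exists>L\<ge>0. \<forall>q\<in>sample_set P. \<forall>q'\<in>sample_set P. \<forall>\<Theta>\<in>relaxed_feasible P x q.
    \<exists>\<Theta>'\<in>relaxed_feasible P x q'. objective \<epsilon> \<Theta>' \<le> objective \<epsilon> \<Theta> + L * dist q q'"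
proof -
  obtain \<Theta>0 \<rho> where \<rho>: "0 < \<rho>" and \<Theta>0: "\<Theta>0 \<in> control_set P" "z2 P x \<Theta>0 T = 0"
    and ball: "\<And>\<beta>. \<beta> \<in> disturbance_set P \<Longrightarrow> cball (z1 P x \<Theta>0 \<beta> T) \<rho> \<subseteq> XF P"
    by (rule uniform_slater) blast
  obtain B where B: "0 < B"
    "\<And>\<Theta> \<beta> \<beta>'. norm (z1 P x \<Theta> \<beta>' T - z1 P x \<Theta> \<beta> T) \<le> B * norm (\<beta>' - \<beta>)"
    using z1_lipschitz_disturbance by blast
  define L where "L = B / \<rho> * objective \<epsilon> \<Theta>0"
  have "0 \<le> L" using B(1) \<rho> objective_nonneg[OF assms] by (simp add: L_def)
  moreover have "\<exists>\<Theta>'\<in>relaxed_feasible P x q'. objective \<epsilon> \<Theta>' \<le> objective \<epsilon> \<Theta> + L * dist q q'"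
    if q: "q \<in> sample_set P" "q' \<in> sample_set P" and \<Theta>: "\<Theta> \<in> relaxed_feasible P x q" for q q' \<Theta>
  proof -
    define \<delta> where "\<delta> = B * dist q q'"
    define s where "s = \<delta> / (\<rho> + \<delta>)"
    define \<Theta>' where "\<Theta>' = (1 - s) *\<^sub>R \<Theta> + s *\<^sub>R \<Theta>0"
    have \<delta>: "0 \<le> \<delta>" using B(1) by (simp add: \<delta>_def)
    have s: "0 \<le> s" "s \<le> 1" "s \<le> \<delta> / \<rho>"
      using \<delta> \<rho> by (auto simp: s_def field_simps)
    have feas: "\<Theta> \<in> control_set P" "z2 P x \<Theta> T = 0" "\<And>i. z1 P x \<Theta> (snd q $ i) T \<in> XF P"
      using \<Theta> by (auto simp: relaxed_feasible_eq[OF q(1)] scenario_feasible_def)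
    have "\<Theta>' \<in> scenario_feasible (snd q' $ i)" for i
    proof -
      define e where "e = z1 P x \<Theta> (snd q' $ i) T - z1 P x \<Theta> (snd q $ i) T"
      have "norm e \<le> B * norm (snd q' $ i - snd q $ i)" unfolding e_def by (rule B(2))
      also have "\<dots> \<le> \<delta>" unfolding \<delta>_def
      proof (rule mult_left_mono)
        have "norm (snd q' $ i - snd q $ i) = dist (snd q $ i) (snd q' $ i)"
          by (metis dist_commute dist_norm)
        also have "\<dots> \<le> dist (snd q) (snd q')" by (rule dist_vec_nth_le)
        also have "\<dots> \<le> dist q q'" by (rule dist_snd_le)
        finally show "norm (snd q' $ i - snd q $ i) \<le> dist q q'" .
      qed (use B(1) in simp)
      finally have e: "norm e \<le> \<delta>" .
      have "snd q' $ i \<in> disturbance_set P" using q(2) by (auto simp: sample_set_def)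
      then have "(1 - s) *\<^sub>R (z1 P x \<Theta> (snd q $ i) T + e) + s *\<^sub>R z1 P x \<Theta>0 (snd q' $ i) T \<in> XF P"
        using convex_shrink_absorbs_error[OF XF(2) feas(3) ball e \<rho> \<delta> s_def] by blast
      then have "z1 P x \<Theta>' (snd q' $ i) T \<in> XF P"
        by (simp add: \<Theta>'_def z1_affine e_def)
      moreover have "\<Theta>' \<in> control_set P"
        unfolding \<Theta>'_def using convexD_alt[OF convex_control_set feas(1) \<Theta>0(1)] s by blast
      ultimately show ?thesis
        using feas(2) \<Theta>0(2) by (simp add: scenario_feasible_def \<Theta>'_def z2_affine)
    qed
    then have "\<Theta>' \<in> relaxed_feasible P x q'" by (simp add: relaxed_feasible_eq[OF q(2)])
    moreover have "objective \<epsilon> \<Theta>' \<le> objective \<epsilon> \<Theta> + L * dist q q'"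
    proof -
      have "objective \<epsilon> \<Theta>' \<le> (1 - s) * objective \<epsilon> \<Theta> + s * objective \<epsilon> \<Theta>0"
        unfolding \<Theta>'_def using convex_onD[OF convex_objective[OF assms]] s by blast
      also have "\<dots> \<le> 1 * objective \<epsilon> \<Theta> + \<delta> / \<rho> * objective \<epsilon> \<Theta>0"
        using s objective_nonneg[OF assms] by (intro add_mono mult_right_mono) auto
      also have "\<dots> = objective \<epsilon> \<Theta> + L * dist q q'" by (simp add: L_def \<delta>_def)
      finally show ?thesis .
    qed
    ultimately show ?thesis by blast
  qed
  ultimately show ?thesis by blast
qed

text \<open>Exchanging the roles of the two samples in \<open>relaxed_feasible_perturbation\<close> makes the optimal value
  Lipschitz.\<close>

lemma continuous_on_G:
  assumes "0 < \<epsilon>"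
  shows "continuous_on (sample_set P) (G P x \<epsilon>)"
proof -
  obtain \<theta> where "\<forall>q\<in>sample_set P. is_arg_min (objective \<epsilon>) (\<lambda>\<Theta>. \<Theta> \<in> relaxed_feasible P x q) (\<theta> q)"
    using bchoice[of "sample_set P"] relaxed_minimizer_exists[OF assms] by meson
  then have \<theta>: "\<And>q. q \<in> sample_set P \<Longrightarrow>
      is_arg_min (objective \<epsilon>) (\<lambda>\<Theta>. \<Theta> \<in> relaxed_feasible P x q) (\<theta> q)" by blast
  obtain L where L: "0 \<le> L" "\<And>q q' \<Theta>. q \<in> sample_set P \<Longrightarrow> q' \<in> sample_set P \<Longrightarrow> \<Theta> \<in> relaxed_feasible P x q \<Longrightarrow>
    \<exists>\<Theta>'\<in>relaxed_feasible P x q'. objective \<epsilon> \<Theta>' \<le> objective \<epsilon> \<Theta> + L * dist q q'"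
    using relaxed_feasible_perturbation[OF assms] by blast
  have le: "objective \<epsilon> (\<theta> q') \<le> objective \<epsilon> (\<theta> q) + L * dist q q'"
    if q: "q \<in> sample_set P" "q' \<in> sample_set P" for q q'
  proof -
    have "\<theta> q \<in> relaxed_feasible P x q" using \<theta>[OF q(1)] by (simp add: is_arg_min_linorder)
    then obtain \<Theta>' where "\<Theta>' \<in> relaxed_feasible P x q'"
      "objective \<epsilon> \<Theta>' \<le> objective \<epsilon> (\<theta> q) + L * dist q q'" using L(2)[OF q] by blast
    moreover from this(1) have "objective \<epsilon> (\<theta> q') \<le> objective \<epsilon> \<Theta>'"
      using \<theta>[OF q(2)] by (simp add: is_arg_min_linorder)
    ultimately show ?thesis by linarith
  qed
  have "L-lipschitz_on (sample_set P) (\<lambda>q. objective \<epsilon> (\<theta> q))"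
  proof (rule lipschitz_onI[OF _ L(1)])
    fix q q' assume "q \<in> sample_set P" "q' \<in> sample_set P"
    then show "dist (objective \<epsilon> (\<theta> q)) (objective \<epsilon> (\<theta> q')) \<le> L * dist q q'"
      using le[of q q'] le[of q' q] by (simp add: dist_real_def abs_le_iff dist_commute)
  qed
  then have "continuous_on (sample_set P) (\<lambda>q. ereal (objective \<epsilon> (\<theta> q)))"
    by (intro continuous_on_ereal lipschitz_on_continuous_on)
  then show ?thesis
    using G_eq_objective[OF \<theta>] by (simp cong: continuous_on_cong)
qed

lemma G_arg_max_exists:
  assumes "0 < \<epsilon>"
  shows "\<exists>q. is_arg_max (G P x \<epsilon>) (\<lambda>q. q \<in> sample_set P) q"
proof -
  have "(0, 0) \<in> sample_set P"
    using T_nonneg zero_in_disturbance_set by (simp add: sample_set_def)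
  then have "sample_set P \<noteq> {}" by blast
  from continuous_attains_sup[OF compact_sample_set this continuous_on_G[OF assms]]
  show ?thesis by (auto simp: is_arg_max_linorder)
qed

section \<open>Equality of the robust and the relaxed value\<close>

text \<open>At most \<open>N\<close> scenarios form a sample: they are enumerated by \<open>'n\<close>, and one of them is repeated to
  fill the remaining places.\<close>

lemma scenario_tuple_exists:
  assumes "finite I'" "I' \<subseteq> disturbance_set P" "I' \<noteq> {}" "card I' \<le> CARD('n)"
  shows "\<exists>q\<in>sample_set P. relaxed_feasible P x q = (\<Inter>\<beta>\<in>I'. scenario_feasible \<beta>)"
proof -
  obtain f :: "real^'m^'d \<Rightarrow> 'n" where f: "inj_on f I'"
    using card_le_inj[OF assms(1) finite assms(4)] by blast
  define g where "g = inv_into I' f"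
  obtain \<beta>0 where \<beta>0: "\<beta>0 \<in> I'" using assms(3) by blast
  define \<bb> :: "(real^'m^'d)^'n" where "\<bb> = (\<chi> i. if i \<in> f ` I' then g i else \<beta>0)"
  have "range (\<lambda>i. \<bb> $ i) = I'"
  proof
    show "range (\<lambda>i. \<bb> $ i) \<subseteq> I'"
      using \<beta>0 by (auto simp: \<bb>_def g_def inv_into_f_f[OF f])
    show "I' \<subseteq> range (\<lambda>i. \<bb> $ i)"
    proof
      fix \<beta> assume "\<beta> \<in> I'"
      then have "\<bb> $ f \<beta> = \<beta>" by (simp add: \<bb>_def g_def inv_into_f_f[OF f])
      then show "\<beta> \<in> range (\<lambda>i. \<bb> $ i)" by (metis rangeI)
    qed
  qed
  moreover from this have "(0, \<bb>) \<in> sample_set P"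
    using T_nonneg assms(2) by (auto simp: sample_set_def)
  moreover have "(\<Inter>i. scenario_feasible (\<bb> $ i)) = (\<Inter>\<beta>\<in>range (\<lambda>i. \<bb> $ i). scenario_feasible \<beta>)"
    by simp
  ultimately show ?thesis
    using relaxed_feasible_eq[of "(0, \<bb>)"] by (intro bexI[of _ "(0, \<bb>)"]) simp_all
qed

text \<open>The maximum of \<open>G\<close> bounds the value of every subprogram with at most \<open>N\<close> scenarios, which is the
  hypothesis of \<open>Helly_convex_program\<close>.\<close>

lemma V_eq_G_arg_max:
  assumes \<epsilon>: "0 < \<epsilon>" and q: "is_arg_max (G P x \<epsilon>) (\<lambda>q. q \<in> sample_set P) q"
  shows "V P x \<epsilon> = G P x \<epsilon> q"
proof -
  have qS: "q \<in> sample_set P" using q by (simp add: is_arg_max_linorder)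
  obtain \<Theta>q where \<Theta>q: "is_arg_min (objective \<epsilon>) (\<lambda>\<Theta>. \<Theta> \<in> relaxed_feasible P x q) \<Theta>q"
    using relaxed_minimizer_exists[OF \<epsilon> qS] by blast
  obtain p where p: "p \<in> robust_feasible P x" using robust_feasible_nonempty by blast
  have "\<exists>\<Theta>\<in>(\<Inter>\<beta>\<in>disturbance_set P. scenario_feasible \<beta>). objective \<epsilon> \<Theta> \<le> objective \<epsilon> \<Theta>q"
  proof (rule Helly_convex_program[where p = p])
    fix I' assume I': "finite I'" "I' \<subseteq> disturbance_set P" "I' \<noteq> {}" "card I' \<le> DIM(real^'n)"
    then have "card I' \<le> CARD('n)" by simp
    then obtain q' where q': "q' \<in> sample_set P" "relaxed_feasible P x q' = (\<Inter>\<beta>\<in>I'. scenario_feasible \<beta>)"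
      using scenario_tuple_exists[OF I'(1-3)] by blast
    obtain \<Theta> where \<Theta>: "is_arg_min (objective \<epsilon>) (\<lambda>\<Theta>. \<Theta> \<in> relaxed_feasible P x q') \<Theta>"
      using relaxed_minimizer_exists[OF \<epsilon> q'(1)] by blast
    have "G P x \<epsilon> q' \<le> G P x \<epsilon> q" using q q'(1) unfolding is_arg_max_linorder by blast
    then have "objective \<epsilon> \<Theta> \<le> objective \<epsilon> \<Theta>q"
      by (simp add: G_eq_objective[OF \<Theta>] G_eq_objective[OF \<Theta>q])
    moreover have "\<Theta> \<in> (\<Inter>\<beta>\<in>I'. scenario_feasible \<beta>)"
      using \<Theta> by (simp add: is_arg_min_linorder flip: q'(2))
    ultimately show "\<exists>\<Theta>\<in>(\<Inter>\<beta>\<in>I'. scenario_feasible \<beta>). objective \<epsilon> \<Theta> \<le> objective \<epsilon> \<Theta>q" by blast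
  qed (use p zero_in_disturbance_set compact_scenario_feasible convex_scenario_feasible
      convex_objective[OF \<epsilon>] in \<open>auto simp: robust_feasible_eq\<close>)
  then obtain \<Theta> where \<Theta>: "\<Theta> \<in> robust_feasible P x" "objective \<epsilon> \<Theta> \<le> objective \<epsilon> \<Theta>q"
    by (auto simp: robust_feasible_eq)
  have "V P x \<epsilon> \<le> ereal (objective \<epsilon> \<Theta>)"
    unfolding V_def objective_def by (rule INF_lower[OF \<Theta>(1)])
  also have "\<dots> \<le> G P x \<epsilon> q" using \<Theta>(2) by (simp add: G_eq_objective[OF \<Theta>q])
  finally have "V P x \<epsilon> \<le> G P x \<epsilon> q" .
  moreover have "G P x \<epsilon> q \<le> V P x \<epsilon>"
    unfolding V_def G_def by (rule INF_superset_mono[OF robust_subset_relaxed[OF qS] order_refl])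
  ultimately show ?thesis by (rule antisym)
qed

section \<open>Vanishing regularization\<close>

lemma relaxed_minimizer_unique:
  assumes "0 < \<epsilon>" "q \<in> sample_set P"
  shows "\<exists>!\<Theta>. is_arg_min (objective \<epsilon>) (\<lambda>\<Theta>. \<Theta> \<in> relaxed_feasible P x q) \<Theta>"
  using relaxed_minimizer_exists[OF assms]
    strictly_convex_arg_min_unique[OF strictly_convex_objective[OF assms(1)] convex_relaxed_feasible[OF assms(2)]]
  by blast

text \<open>A robust minimizer is feasible for the relaxed program at \<open>q\<close> and attains its value, since the values
  agree; by uniqueness it equals \<open>\<Theta>\<close>. Hence the feasible set of the minimization no longer varies
  with \<open>\<epsilon>\<close>.\<close>

lemma relaxed_minimizer_robust:
  assumes \<epsilon>: "0 < \<epsilon>" and q: "is_arg_max (G P x \<epsilon>) (\<lambda>q. q \<in> sample_set P) q"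
    and \<Theta>: "is_arg_min (objective \<epsilon>) (\<lambda>\<Theta>. \<Theta> \<in> relaxed_feasible P x q) \<Theta>"
  shows "is_arg_min (objective \<epsilon>) (\<lambda>\<Theta>. \<Theta> \<in> robust_feasible P x) \<Theta>"
proof -
  have qS: "q \<in> sample_set P" using q by (simp add: is_arg_max_linorder)
  obtain \<Theta>' where \<Theta>': "is_arg_min (objective \<epsilon>) (\<lambda>\<Theta>. \<Theta> \<in> robust_feasible P x) \<Theta>'"
    using robust_minimizer_exists[OF \<epsilon>] by blast
  have "objective \<epsilon> \<Theta>' = objective \<epsilon> \<Theta>"
    using V_eq_G_arg_max[OF \<epsilon> q] by (simp add: V_eq_objective[OF \<Theta>'] G_eq_objective[OF \<Theta>])
  moreover have "\<Theta>' \<in> relaxed_feasible P x q"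
    using \<Theta>' robust_subset_relaxed[OF qS] by (auto simp: is_arg_min_linorder)
  ultimately have "is_arg_min (objective \<epsilon>) (\<lambda>\<Theta>. \<Theta> \<in> relaxed_feasible P x q) \<Theta>'"
    using \<Theta> by (simp add: is_arg_min_linorder)
  then have "\<Theta>' = \<Theta>" using relaxed_minimizer_unique[OF \<epsilon> qS] \<Theta> by blast
  with \<Theta>' show ?thesis by simp
qed

lemma relaxed_minimizers_converge:
  assumes q: "\<And>\<epsilon>. 0 < \<epsilon> \<Longrightarrow> is_arg_max (G P x \<epsilon>) (\<lambda>q. q \<in> sample_set P) (q \<epsilon>)"
    and \<Theta>: "\<And>\<epsilon>. 0 < \<epsilon> \<Longrightarrow> is_arg_min (objective \<epsilon>) (\<lambda>\<Theta>. \<Theta> \<in> relaxed_feasible P x (q \<epsilon>)) (\<Theta> \<epsilon>)"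
  shows "\<exists>\<Theta>0. is_arg_min (J P) (\<lambda>\<Theta>. \<Theta> \<in> robust_feasible P x) \<Theta>0 \<and> (\<Theta> \<longlongrightarrow> \<Theta>0) (at_right 0)"
  using relaxed_minimizer_robust[OF _ q \<Theta>]
  by (intro regularized_minimizers_converge[OF compact_robust_feasible convex_robust_feasible
        robust_feasible_nonempty convex_J reg(2) reg(1)])
    (simp add: objective_def[abs_def])

end
theorem corollaryV1:
  fixes P :: "('d::finite, 'n::finite, 'm::finite) attention_problem"
    and h :: real and K :: nat and xbar :: "real^'d"
  assumes "0 < horizon P" and "0 < rate P" and "\<And>j. 0 < wbar P $ j"
    and "compact (XF P)" and "convex (XF P)" and "0 \<in> interior (XF P)"
    and "0 < h" and "real K * h \<le> horizon P" and "horizon P - real K * h \<le> h"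
    and "\<And>i. (\<lambda>t. Psi P t $ i) \<in> PC h K (horizon P)"
    and "\<And>c. (\<And>t. t \<in> {0..horizon P} \<Longrightarrow> (\<Sum>i\<in>UNIV. c i * Psi P t $ i) = 0) \<Longrightarrow> \<forall>i. c i = 0"
    and "(MAX i. MAX t\<in>{0..horizon P}. \<bar>Psi P t $ i\<bar>) = 1"
    and "\<And>j. (\<lambda>t. Phi P t $ j) \<in> PC h K (horizon P)"
    and "\<And>c. (\<And>t. t \<in> {0..horizon P} \<Longrightarrow> (\<Sum>j\<in>UNIV. c j * Phi P t $ j) = 0) \<Longrightarrow> \<forall>j. c j = 0"
    and "(MAX j. MAX t\<in>{0..horizon P}. \<bar>Phi P t $ j\<bar>) = 1"
    and "continuous_on UNIV (reg P)" and "\<And>\<Theta>. 0 < reg P \<Theta>" and "strictly_convex_on UNIV (reg P)"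
    and "\<And>\<epsilon>. 0 < \<epsilon> \<Longrightarrow> xbar \<in> feasible_states P \<epsilon>"
    and "strictly_feasible P xbar"
  shows "(\<forall>\<epsilon>>0. continuous_on (sample_set P) (G P xbar \<epsilon>) \<and>
      (\<exists>q. is_arg_max (G P xbar \<epsilon>) (\<lambda>q. q \<in> sample_set P) q)) \<and>
    (\<forall>\<epsilon>>0. \<forall>q. is_arg_max (G P xbar \<epsilon>) (\<lambda>q. q \<in> sample_set P) q \<longrightarrow>
      V P xbar \<epsilon> = G P xbar \<epsilon> q) \<and>
    (\<forall>q. (\<forall>\<epsilon>>0. is_arg_max (G P xbar \<epsilon>) (\<lambda>q. q \<in> sample_set P) (q \<epsilon>)) \<longrightarrow>
      (\<forall>\<epsilon>>0. \<exists>!\<Theta>. is_arg_min (\<lambda>\<Theta>. J P \<Theta> + \<epsilon> * reg P \<Theta>)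
                      (\<lambda>\<Theta>. \<Theta> \<in> relaxed_feasible P xbar (q \<epsilon>)) \<Theta>) \<and>
      (\<forall>\<Theta>s. (\<forall>\<epsilon>>0. is_arg_min (\<lambda>\<Theta>. J P \<Theta> + \<epsilon> * reg P \<Theta>)
                      (\<lambda>\<Theta>. \<Theta> \<in> relaxed_feasible P xbar (q \<epsilon>)) (\<Theta>s \<epsilon>)) \<longrightarrow>
        (\<exists>\<Theta>0. is_arg_min (J P) (\<lambda>\<Theta>. \<Theta> \<in> robust_feasible P xbar) \<Theta>0 \<and>
               (\<Theta>s \<longlongrightarrow> \<Theta>0) (at_right 0))))"
proof -
  interpret robust_attention P h K xbar
    by (rule robust_attention.intro) (fact assms | (rule assms, blast))+
  have obj: "(\<lambda>\<Theta>. J P \<Theta> + \<epsilon> * reg P \<Theta>) = objective \<epsilon>" for \<epsilon>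
    by (simp add: objective_def[abs_def])
  show ?thesis
    unfolding obj
  proof (intro conjI allI impI)
    fix \<epsilon> :: real assume \<epsilon>: "0 < \<epsilon>"
    show "continuous_on (sample_set P) (G P xbar \<epsilon>)" using \<epsilon> by (rule continuous_on_G)
    show "\<exists>q. is_arg_max (G P xbar \<epsilon>) (\<lambda>q. q \<in> sample_set P) q" using \<epsilon> by (rule G_arg_max_exists)
  next
    fix \<epsilon> :: real and q
    assume "0 < \<epsilon>" "is_arg_max (G P xbar \<epsilon>) (\<lambda>q. q \<in> sample_set P) q"
    then show "V P xbar \<epsilon> = G P xbar \<epsilon> q" by (rule V_eq_G_arg_max)
  next
    fix q and \<epsilon> :: real
    assume q: "\<forall>\<epsilon>>0. is_arg_max (G P xbar \<epsilon>) (\<lambda>q. q \<in> sample_set P) (q \<epsilon>)" and \<epsilon>: "0 < \<epsilon>"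
    then show "\<exists>!\<Theta>. is_arg_min (objective \<epsilon>) (\<lambda>\<Theta>. \<Theta> \<in> relaxed_feasible P xbar (q \<epsilon>)) \<Theta>"
      using relaxed_minimizer_unique[OF \<epsilon>] by (simp add: is_arg_max_def)
  next
    fix q \<Theta>s
    assume "\<forall>\<epsilon>>0. is_arg_max (G P xbar \<epsilon>) (\<lambda>q. q \<in> sample_set P) (q \<epsilon>)"
      "\<forall>\<epsilon>>0. is_arg_min (objective \<epsilon>) (\<lambda>\<Theta>. \<Theta> \<in> relaxed_feasible P xbar (q \<epsilon>)) (\<Theta>s \<epsilon>)"
    then show "\<exists>\<Theta>0. is_arg_min (J P) (\<lambda>\<Theta>. \<Theta> \<in> robust_feasible P xbar) \<Theta>0 \<and> (\<Theta>s \<longlongrightarrow> \<Theta>0) (at_right 0)"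
      by (intro relaxed_minimizers_converge[of q]) simp_all
  qed
qed

end
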